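(* Let $\mathcal{A}\in\mathbb{H}^{I_{1}\times \cdots \times I_{N}\times J_{1}\times \cdots \times J_{N}}$, $\mathcal{B}\in\mathbb{H}^{K_{1}\times \cdots \times K_{M}\times L_{1}\times \cdots \times L_{M}}$, $\mathcal{C}\in\mathbb{H}^{I_{1}\times \cdots \times I_{N}\times G_{1}\times \cdots \times G_{N}}$, $\mathcal{D}\in\mathbb{H}^{H_{1}\times \cdots \times H_{M}\times L_{1}\times \cdots \times L_{M}}$ and $\mathcal{E}\in\mathbb{H}^{I_{1}\times \cdots \times I_{N}\times L_{1}\times \cdots \times L_{M}}$. Set $$\mathcal{P}=\mathcal{R}_{\mathcal{A}}*_{N}\mathcal{C},\quad \mathcal{Q}=\mathcal{D}*_{M}\mathcal{L}_{\mathcal{B}},\quad \mathcal{S}=\mathcal{C}*_{N}\mathcal{L}_{\mathcal{P}}.$$ Then the generalized Sylvester quaternion tensor equation $$\mathcal{A}*_{N}\mathcal{X}*_{M}\mathcal{B}+\mathcal{C}*_{N}\mathcal{Y}*_{M}\mathcal{D}=\mathcal{E}$$ in the unknowns $\mathcal{X}\in\mathbb{H}^{J_{1}\times \cdots \times J_{N}\times K_{1}\times \cdots \times K_{M}}$, $\mathcal{Y}\in\mathbb{H}^{G_{1}\times \cdots \times G_{N}\times H_{1}\times \cdots \times H_{M}}$ is consistent if and only if $$\mathcal{R}_{\mathcal{P}}*_{N}\mathcal{R}_{\mathcal{A}}*_{N}\mathcal{E}=0,\quad \mathcal{E}*_{M}\mathcal{L}_{\mathcal{B}}*_{M}\mathcal{L}_{\mathcal{Q}}=0,\quad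 \mathcal{R}_{\mathcal{A}}*_{N}\mathcal{E}*_{M}\mathcal{L}_{\mathcal{D}}=0,\quad \mathcal{R}_{\mathcal{C}}*_{N}\mathcal{E}*_{M}\mathcal{L}_{\mathcal{B}}=0.$$ In this case, the general solution can be expressed as $$\begin{aligned}\mathcal{X}=&\ \mathcal{A}^{\dag}*_{N}\mathcal{E}*_{M}\mathcal{B}^{\dag}-\mathcal{A}^{\dag}*_{N}\mathcal{C}*_{N}\mathcal{P}^{\dag}*_{N}\mathcal{E}*_{M}\mathcal{B}^{\dag}-\mathcal{A}^{\dag}*_{N}\mathcal{S}*_{N}\mathcal{C}^{\dag}*_{N}\mathcal{E}*_{M}\mathcal{Q}^{\dag}*_{M}\mathcal{D}*_{M}\mathcal{B}^{\dag}\\&-\mathcal{A}^{\dag}*_{N}\mathcal{S}*_{N}\mathcal{U}_{2}*_{M}\mathcal{R}_{\mathcal{Q}}*_{M}\mathcal{D}*_{M}\mathcal{B}^{\dag}+\mathcal{L}_{\mathcal{A}}*_{N}\mathcal{U}_{4}+\mathcal{U}_{5}*_{M}\mathcal{R}_{\mathcal{B}},\end{aligned}$$ $$\begin{aligned}\mathcal{Y}=&\ \mathcal{P}^{\dag}*_{N}\mathcal{E}*_{M}\mathcal{D}^{\dag}+\mathcal{S}^{\dag}*_{N}\mathcal{S}*_{N}\mathcal{C}^{\dag}*_{N}\mathcal{E}*_{M}\mathcal{Q}^{\dag}+\mathcal{L}_{\mathcal{P}}*_{N}\mathcal{L}_{\mathcal{S}}*_{N}\mathcal{U}_{1}\\&+\mathcal{L}_{\mathcal{P}}*_{N}\mathcal{U}_{2}*_{M}\mathcal{R}_{\mathcal{Q}}+\mathcal{U}_{3}*_{M}\mathcal{R}_{\mathcal{D}},\end{aligned}$$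 where $\mathcal{U}_{1},\mathcal{U}_{2},\mathcal{U}_{3}\in\mathbb{H}^{G_{1}\times \cdots \times G_{N}\times H_{1}\times \cdots \times H_{M}}$ and $\mathcal{U}_{4},\mathcal{U}_{5}\in\mathbb{H}^{J_{1}\times \cdots \times J_{N}\times K_{1}\times \cdots \times K_{M}}$ are arbitrary quaternion tensors (that is, the set of solutions $(\mathcal{X},\mathcal{Y})$ is exactly the set of pairs of this form).
   Context: $\mathbb{H}$ is the real quaternion algebra $\{q_0+q_1\mathbf{i}+q_2\mathbf{j}+q_3\mathbf{k}: q_0,\ldots,q_3\in\mathbb{R}\}$ with $\mathbf{i}^2=\mathbf{j}^2=\mathbf{k}^2=\mathbf{ijk}=-1$, and $\bar q=q_0-q_1\mathbf{i}-q_2\mathbf{j}-q_3\mathbf{k}$. $\mathbb{H}^{I_1\times\cdots\times I_N}$ is the set of order $N$ arrays $(a_{i_1\cdots i_N})_{1\le i_j\le I_j}$ with quaternion entries. Einstein product: $*_n$ contracts the last $n$ indices of the left factor with the first $n$ indices of the right factor; e.g. for $\mathcal{A}\in\mathbb{H}^{I_{1}\times \cdots \times I_{N}\times J_{1}\times \cdots \times J_{N}}$ and $\mathcal{B}\in\mathbb{H}^{J_{1}\times \cdots \times J_{N}\times K_{1}\times \cdots \times K_{M}}$, $(\mathcal{A}*_{N}\mathcal{B})_{i_{1}\cdots i_{N}k_{1}\cdots k_{M}}=\sum_{j_{1}\cdots j_{N}}a_{i_{1}\cdots i_{N}j_{1}\cdots j_{N}}b_{j_{1}\cdots j_{N}k_{1}\cdots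 k_{M}}$. This product is associative. Conjugate transpose: $(\mathcal{A}^* )_{j_1\cdots j_Ni_1\cdots i_N}=\overline{a_{i_1\cdots i_Nj_1\cdots j_N}}$. The unit tensor $\mathcal{I}$ (of square size) has entry $1$ at positions $(i_1,\ldots,i_N,i_1,\ldots,i_N)$ and $0$ elsewhere. Moore-Penrose inverse: for $\mathcal{A}\in\mathbb{H}^{I_{1}\times \cdots \times I_{N}\times J_{1}\times \cdots \times J_{N}}$, $\mathcal{A}^{\dag}\in\mathbb{H}^{J_{1}\times \cdots \times J_{N}\times I_{1}\times \cdots \times I_{N}}$ is the (unique, existing) tensor $\mathcal{X}$ satisfying $\mathcal{A}*_{N}\mathcal{X}*_{N}\mathcal{A}=\mathcal{A}$, $\mathcal{X}*_{N}\mathcal{A}*_{N}\mathcal{X}=\mathcal{X}$, $(\mathcal{A}*_{N}\mathcal{X})^{*}=\mathcal{A}*_{N}\mathcal{X}$, $(\mathcal{X}*_{N}\mathcal{A})^{*}=\mathcal{X}*_{N}\mathcal{A}$ (with $M$ in place of $N$ for tensors with $M+M$ modes). Notation: $\mathcal{L}_{\mathcal{A}}=\mathcal{I}-\mathcal{A}^{\dag}*_{N}\mathcal{A}$ and $\mathcal{R}_{\mathcal{A}}=\mathcal{I}-\mathcal{A}*_{N}\mathcal{A}^{\dag}$ (with $*_M$ for tensors with $M+M$ modes), with unit tensors of the appropriate size. $0$ denotes the zero tensor. *)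

theory Defs
  imports Complex_Main
begin

datatype quaternion = Quat (q0: real) (q1: real) (q2: real) (q3: real)

lemma quaternion_eq_iff:
  "p = q \<longleftrightarrow> q0 p = q0 q \<and> q1 p = q1 q \<and> q2 p = q2 q \<and> q3 p = q3 q"
  by (cases p; cases q) simp

instantiation quaternion :: ring_1
begin

definition "0 = Quat 0 0 0 0"
definition "1 = Quat 1 0 0 0"
definition "p + q = Quat (q0 p + q0 q) (q1 p + q1 q) (q2 p + q2 q) (q3 p + q3 q)"
definition "p - q = Quat (q0 p - q0 q) (q1 p - q1 q) (q2 p - q2 q) (q3 p - q3 q)"
definition "- q = Quat (- q0 q) (- q1 q) (- q2 q) (- q3 q)"
definition "p * q = Quat
  (q0 p * q0 q - q1 p * q1 q - q2 p * q2 q - q3 p * q3 q)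
  (q0 p * q1 q + q1 p * q0 q + q2 p * q3 q - q3 p * q2 q)
  (q0 p * q2 q - q1 p * q3 q + q2 p * q0 q + q3 p * q1 q)
  (q0 p * q3 q + q1 p * q2 q - q2 p * q1 q + q3 p * q0 q)"

instance
  by standard
    (simp_all add: quaternion_eq_iff zero_quaternion_def one_quaternion_def plus_quaternion_def
      minus_quaternion_def uminus_quaternion_def times_quaternion_def algebra_simps)

end

definition quat_i :: quaternion where "quat_i = Quat 0 1 0 0"
definition quat_j :: quaternion where "quat_j = Quat 0 0 1 0"
definition quat_k :: quaternion where "quat_k = Quat 0 0 0 1"

lemma quaternion_units:
  "quat_i * quat_i = -1" "quat_j * quat_j = -1" "quat_k * quat_k = -1"
  "quat_i * quat_j * quat_k = -1"
  by (simp_all add: quat_i_def quat_j_def quat_k_def times_quaternion_def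
      uminus_quaternion_def one_quaternion_def)

definition qcnj :: "quaternion \<Rightarrow> quaternion" where
  "qcnj q = Quat (q0 q) (- q1 q) (- q2 q) (- q3 q)"

definition multi_indices :: "nat list \<Rightarrow> nat list set" where
  "multi_indices ds = {ix. list_all2 (\<lambda>i d. 1 \<le> i \<and> i \<le> d) ix ds}"

text \<open>
  A tensor carries its list of mode sizes together with its entries. Entries outside the index
  range are fixed to be 0, so that equality of tensors means equal sizes and equal entries.
\<close>

typedef tensor =
  "{(ds :: nat list, f :: nat list \<Rightarrow> quaternion). \<forall>ix. ix \<notin> multi_indices ds \<longrightarrow> f ix = 0}"
  by (rule exI[of _ "([], \<lambda>_. 0)"]) simp

definition dims :: "tensor \<Rightarrow> nat list" where
  "dims A = fst (Rep_tensor A)"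

definition entry :: "tensor \<Rightarrow> nat list \<Rightarrow> quaternion" where
  "entry A = snd (Rep_tensor A)"

definition mk_tensor :: "nat list \<Rightarrow> (nat list \<Rightarrow> quaternion) \<Rightarrow> tensor" where
  "mk_tensor ds f = Abs_tensor (ds, \<lambda>ix. if ix \<in> multi_indices ds then f ix else 0)"

lemma Rep_mk_tensor:
  "Rep_tensor (mk_tensor ds f) = (ds, \<lambda>ix. if ix \<in> multi_indices ds then f ix else 0)"
  unfolding mk_tensor_def by (rule Abs_tensor_inverse) auto

lemma dims_mk_tensor [simp]: "dims (mk_tensor ds f) = ds"
  by (simp add: dims_def Rep_mk_tensor)

lemma entry_mk_tensor [simp]:
  "entry (mk_tensor ds f) ix = (if ix \<in> multi_indices ds then f ix else 0)"
  by (simp add: entry_def Rep_mk_tensor)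

lemma entry_outside: "ix \<notin> multi_indices (dims A) \<Longrightarrow> entry A ix = 0"
  using Rep_tensor[of A] by (auto simp: dims_def entry_def split: prod.splits)

lemma tensor_eqI:
  assumes "dims A = dims B" and "\<And>ix. ix \<in> multi_indices (dims A) \<Longrightarrow> entry A ix = entry B ix"
  shows "A = B"
proof -
  have "entry A = entry B"
    using assms entry_outside[of _ A] entry_outside[of _ B] by (metis ext)
  with assms(1) show ?thesis
    by (simp add: dims_def entry_def prod_eq_iff flip: Rep_tensor_inject)
qed

definition tensors :: "nat list \<Rightarrow> tensor set" where
  "tensors ds = {A. dims A = ds}"

definition zero_tensor :: "nat list \<Rightarrow> tensor" where
  "zero_tensor ds = mk_tensor ds (\<lambda>_. 0)"

text \<open>Addition and subtraction are only meaningful for tensors of equal sizes.\<close>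

instantiation tensor :: "{plus, minus}"
begin
definition "A + B = mk_tensor (dims A) (\<lambda>ix. entry A ix + entry B ix)"
definition "A - B = mk_tensor (dims A) (\<lambda>ix. entry A ix - entry B ix)"
instance ..
end

definition einstein :: "tensor \<Rightarrow> nat \<Rightarrow> tensor \<Rightarrow> tensor"
    (\<open>(_ \<star>\<^bsub>_\<^esub> _)\<close> [70, 0, 71] 70) where
  "A \<star>\<^bsub>n\<^esub> B =
    (let r = length (dims A) - n in
      mk_tensor (take r (dims A) @ drop n (dims B))
        (\<lambda>ix. \<Sum>j \<in> multi_indices (take n (dims B)).
           entry A (take r ix @ j) * entry B (j @ drop r ix)))"

lemma dims_einstein:
  assumes "A \<in> tensors (I @ J)" "B \<in> tensors (J @ K)" "length J = n"
  shows "A \<star>\<^bsub>n\<^esub> B \<in> tensors (I @ K)"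
  using assms by (auto simp: tensors_def einstein_def Let_def)

lemma entry_einstein:
  assumes "A \<in> tensors (I @ J)" "B \<in> tensors (J @ K)" "length J = n"
    and "i \<in> multi_indices I" "k \<in> multi_indices K"
  shows "entry (A \<star>\<^bsub>n\<^esub> B) (i @ k) = (\<Sum>j \<in> multi_indices J. entry A (i @ j) * entry B (j @ k))"
proof -
  have "i @ k \<in> multi_indices (I @ K)" and "length i = length I"
    using assms(4,5) by (auto simp: multi_indices_def list_all2_appendI dest: list_all2_lengthD)
  then show ?thesis
    using assms(1-3) by (auto simp: tensors_def einstein_def Let_def)
qed

text \<open>
  For a tensor with \<open>N + N\<close> modes, the first \<open>N\<close> and the last \<open>N\<close> mode sizes; \<open>N\<close> is recovered
  as half of the order. The notions below are meant for tensors of this kind only.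
\<close>

definition half :: "tensor \<Rightarrow> nat" where
  "half A = length (dims A) div 2"

definition row_dims :: "tensor \<Rightarrow> nat list" where
  "row_dims A = take (half A) (dims A)"

definition col_dims :: "tensor \<Rightarrow> nat list" where
  "col_dims A = drop (half A) (dims A)"

definition conj_transpose :: "tensor \<Rightarrow> tensor" (\<open>(_\<^sup>\<star>)\<close> [1000] 999) where
  "A\<^sup>\<star> = mk_tensor (col_dims A @ row_dims A)
     (\<lambda>ix. qcnj (entry A (drop (length (col_dims A)) ix @ take (length (col_dims A)) ix)))"

lemma entry_conj_transpose:
  assumes "A \<in> tensors (I @ J)" "length I = N" "length J = N"
    and "i \<in> multi_indices I" "j \<in> multi_indices J"
  shows "entry (A\<^sup>\<star>) (j @ i) = qcnj (entry A (i @ j))"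
proof -
  have "j @ i \<in> multi_indices (J @ I)" and "length j = length J"
    using assms(4,5) by (auto simp: multi_indices_def list_all2_appendI dest: list_all2_lengthD)
  then show ?thesis
    using assms(1-3)
    by (auto simp: tensors_def conj_transpose_def row_dims_def col_dims_def half_def)
qed

definition unit_tensor :: "nat list \<Rightarrow> tensor" where
  "unit_tensor ds = mk_tensor (ds @ ds)
     (\<lambda>ix. if take (length ds) ix = drop (length ds) ix then 1 else 0)"

definition is_MP_inverse :: "tensor \<Rightarrow> tensor \<Rightarrow> bool" where
  "is_MP_inverse A X \<longleftrightarrow>
     X \<in> tensors (col_dims A @ row_dims A) \<and>
     A \<star>\<^bsub>half A\<^esub> X \<star>\<^bsub>half A\<^esub> A = A \<and>
     X \<star>\<^bsub>half A\<^esub> A \<star>\<^bsub>half A\<^esub> X = X \<and>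
     (A \<star>\<^bsub>half A\<^esub> X)\<^sup>\<star> = A \<star>\<^bsub>half A\<^esub> X \<and>
     (X \<star>\<^bsub>half A\<^esub> A)\<^sup>\<star> = X \<star>\<^bsub>half A\<^esub> A"

definition MP_inverse :: "tensor \<Rightarrow> tensor" (\<open>(_\<^sup>\<dagger>)\<close> [1000] 999) where
  "A\<^sup>\<dagger> = (THE X. is_MP_inverse A X)"

definition L_proj :: "tensor \<Rightarrow> tensor" (\<open>\<L>\<^bsub>_\<^esub>\<close>) where
  "\<L>\<^bsub>A\<^esub> = unit_tensor (col_dims A) - A\<^sup>\<dagger> \<star>\<^bsub>half A\<^esub> A"

definition R_proj :: "tensor \<Rightarrow> tensor" (\<open>\<R>\<^bsub>_\<^esub>\<close>) where
  "\<R>\<^bsub>A\<^esub> = unit_tensor (row_dims A) - A \<star>\<^bsub>half A\<^esub> A\<^sup>\<dagger>"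

end

theory Submission imports Defs begin

text \<open>
  The finitely supported quaternion matrices indexed by multi-indices form a ring without unit in
  which tensors of all sizes live as corners, the Einstein product being matrix multiplication and
  the unit tensors idempotents. This ring is *-regular: the involution is proper since
  \<open>\<Sum> \<bar>a\<^sub>i\<^sub>k\<bar>\<^sup>2 = 0\<close> forces \<open>a = 0\<close>, and regularity follows by clearing one row at a time, because \<open>a\<close> is
  regular as soon as some \<open>a - a u a\<close> is (McCoy). In a *-regular ring, inner inverses \<open>g\<close> of \<open>a\<^sup>* a\<close>
  and \<open>h\<close> of \<open>a a\<^sup>*\<close> give the Moore-Penrose inverse \<open>a\<^sup>\<dagger> = a\<^sup>* h a g a\<^sup>*\<close>.

  The theorem is then an identity in such a ring. The relations \<open>p\<^sup>\<dagger> a = 0\<close>, \<open>b q\<^sup>\<dagger> = 0\<close>,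
  \<open>s p\<^sup>\<dagger> = 0\<close>, \<open>p s\<^sup>\<dagger> = 0\<close> and \<open>a a\<^sup>\<dagger> s = s\<close> make the given pair a solution, and a solution
  \<open>(x, y)\<close> is recovered from the parameters \<open>u\<^sub>1 = y\<close>, \<open>u\<^sub>2 = s\<^sup>\<dagger> s y\<close>, \<open>u\<^sub>3 = p\<^sup>\<dagger> p y\<close>, \<open>u\<^sub>4 = x\<close>,
  \<open>u\<^sub>5 = a\<^sup>\<dagger> a x\<close>.
\<close>

subsection \<open>Moore-Penrose inverses in *-regular rings\<close>

text \<open>The class extends \<open>ring\<close> and not \<open>ring_1\<close>, since matrices of
  all finite sizes, taken together, have no common unit. The existence of pseudoinverses rests on
  the last two axioms.\<close>

class star_regular_ring = ring +
  fixes adj :: "'a \<Rightarrow> 'a"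
  assumes adj_add: "adj (x + y) = adj x + adj y"
    and adj_mult: "adj (x * y) = adj y * adj x"
    and adj_adj [simp]: "adj (adj x) = x"
    and adj_mult_self_eq_0: "adj x * x = 0 \<Longrightarrow> x = 0"
    and regular: "\<exists>y. x * y * x = x"
begin

lemma adj_0 [simp]: "adj 0 = 0"
  using adj_add[of 0 0] by simp

lemma adj_diff: "adj (x - y) = adj x - adj y"
  by (metis adj_add add_diff_cancel diff_add_cancel)

section \<open>Uniqueness and existence of solutions of the Penrose equations\<close>

definition is_pinv :: "'a \<Rightarrow> 'a \<Rightarrow> bool" where
  "is_pinv a x \<longleftrightarrow> a * x * a = a \<and> x * a * x = x \<and> adj (a * x) = a * x \<and> adj (x * a) = x * a"

text \<open>Penrose's argument: \<open>a * x\<close> and \<open>a * y\<close> are self-adjoint and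
  each absorbs the other from the left, so taking adjoints shows them equal; likewise
  \<open>x * a = y * a\<close>. Then \<open>x = x * a * x = y * a * y = y\<close>.\<close>

lemma is_pinv_unique:
  assumes x: "is_pinv a x" and y: "is_pinv a y"
  shows "x = y"
proof -
  have ax: "a * x = a * y"
  proof -
    have "a * x = (a * y) * (a * x)"
      using y by (simp add: is_pinv_def mult_assoc[symmetric])
    also have "\<dots> = adj ((a * x) * (a * y))"
      using x y by (simp add: is_pinv_def adj_mult[of "a * x"])
    also have "(a * x) * (a * y) = a * y"
      using x by (simp add: is_pinv_def mult_assoc[symmetric])
    also have "adj (a * y) = a * y"
      using y by (simp add: is_pinv_def)
    finally show ?thesis .
  qed
  have xa: "x * a = y * a"
  proof -
    have "x * a = (x * a) * (y * a)"
      using y by (simp add: is_pinv_def mult_assoc)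
    also have "\<dots> = adj ((y * a) * (x * a))"
      using x y by (simp add: is_pinv_def adj_mult[of "y * a"])
    also have "(y * a) * (x * a) = y * a"
      using x by (simp add: is_pinv_def mult_assoc)
    also have "adj (y * a) = y * a"
      using y by (simp add: is_pinv_def)
    finally show ?thesis .
  qed
  have "x = x * a * x" using x by (simp add: is_pinv_def)
  also have "\<dots> = y * a * y" by (simp add: xa ax mult_assoc)
  also have "\<dots> = y" using y by (simp add: is_pinv_def)
  finally show ?thesis .
qed

text \<open>Let \<open>g\<close> be an inner inverse of \<open>adj a * a\<close>. The defect
  \<open>w\<close> satisfies \<open>adj a * w = 0\<close>, and \<open>adj w\<close> is a left
  multiple of \<open>adj a\<close>, so \<open>adj w * w = 0\<close>, and properness of the
  involution gives \<open>w = 0\<close>.\<close>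

lemma ex_right_cancel_adj: "\<exists>g. a * g * adj a * a = a"
proof -
  obtain g where g: "adj a * a * g * (adj a * a) = adj a * a"
    using regular[of "adj a * a"] by blast
  define w where "w = a * g * adj a * a - a"
  have 0: "adj a * w = 0"
    using g by (simp add: w_def right_diff_distrib mult_assoc)
  have "adj w = adj a * a * adj g * adj a - adj a"
    by (simp add: w_def adj_diff adj_mult mult_assoc)
  then have "adj w * w = (adj a * a * adj g) * (adj a * w) - adj a * w"
    by (simp add: left_diff_distrib mult_assoc)
  then have "w = 0"
    using adj_mult_self_eq_0[of w] 0 by simp
  then show ?thesis by (auto simp: w_def)
qed

text \<open>Applied with \<open>w\<close> of the form \<open>adj u * u\<close> or
  \<open>u * adj u\<close>, which is self-adjoint for free; it then suffices to compute that
  \<open>w\<close> equals \<open>adj u\<close>.\<close>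

lemma self_adjoint_of_eq_adj:
  assumes "adj w = w" and "w = adj u"
  shows "adj u = u"
  using assms(1) unfolding assms(2) adj_adj by (rule sym)

text \<open>Two inner inverses of \<open>a\<close> are glued: \<open>y\<close> makes
  \<open>y * a\<close> self-adjoint and \<open>z\<close> makes \<open>a * z\<close> self-adjoint.
  The product \<open>y * a * z\<close> inherits both properties, because
  \<open>a * (y * a * z) = a * z\<close> and \<open>(y * a * z) * a = y * a\<close>.\<close>

lemma ex_is_pinv: "\<exists>x. is_pinv a x"
proof -
  obtain g where g: "a * g * adj a * a = a"
    using ex_right_cancel_adj[of a] by (elim exE)
  obtain h where h0: "adj a * h * adj (adj a) * adj a = adj a"
    using ex_right_cancel_adj[of "adj a"] by (elim exE)
  have h: "a * adj a * adj h * a = a"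
    using arg_cong[OF h0, of adj] by (simp only: adj_mult adj_adj mult_assoc)
  define y z where "y = adj a * adj h" and "z = g * adj a"
  have aya: "a * y * a = a" and aza: "a * z * a = a"
    using g h by (simp_all only: y_def z_def mult_assoc)
  have ya: "adj (y * a) = y * a"
  proof (rule self_adjoint_of_eq_adj)
    show "adj (adj (y * a) * (y * a)) = adj (y * a) * (y * a)"
      by (simp only: adj_mult adj_adj)
    have "adj (y * a) * (y * a) = (adj a * h) * (a * adj a * adj h * a)"
      by (simp only: y_def adj_mult adj_adj mult_assoc)
    also have "\<dots> = adj (y * a)"
      by (simp only: h) (simp only: y_def adj_mult adj_adj mult_assoc)
    finally show "adj (y * a) * (y * a) = adj (y * a)" .
  qed
  have az: "adj (a * z) = a * z"
  proof (rule self_adjoint_of_eq_adj)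
    show "adj (a * z * adj (a * z)) = a * z * adj (a * z)"
      by (simp only: adj_mult adj_adj)
    have "a * z * adj (a * z) = (a * g * adj a * a) * (adj g * adj a)"
      by (simp only: z_def adj_mult adj_adj mult_assoc)
    also have "\<dots> = adj (a * z)"
      by (simp only: g) (simp only: z_def adj_mult adj_adj mult_assoc)
    finally show "a * z * adj (a * z) = adj (a * z)" .
  qed
  have axz: "a * (y * a * z) = a * z"
    using aya by (simp only: mult_assoc[symmetric])
  have zxa: "(y * a * z) * a = y * a"
    using aza by (simp only: mult_assoc)
  have "y * a * (y * a * z) = y * (a * y * a) * z"
    by (simp only: mult_assoc)
  then have "y * a * (y * a * z) = y * a * z"
    by (simp only: aya)
  then have "is_pinv a (y * a * z)"
    unfolding is_pinv_def axz zxa by (simp only: aya aza ya az simp_thms)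
  then show ?thesis ..
qed

definition pinv :: "'a \<Rightarrow> 'a" where
  "pinv a = (THE x. is_pinv a x)"

lemma is_pinv_pinv: "is_pinv a (pinv a)"
proof -
  obtain x where "is_pinv a x"
    using ex_is_pinv[of a] by (elim exE)
  then show ?thesis
    unfolding pinv_def by (rule theI) (rule is_pinv_unique[OF _ \<open>is_pinv a x\<close>])
qed

lemma pinv_eqI: "is_pinv a x \<Longrightarrow> pinv a = x"
  by (rule is_pinv_unique[OF is_pinv_pinv])

lemma pinv_inner: "a * (pinv a * a) = a"
  and pinv_outer: "pinv a * (a * pinv a) = pinv a"
  and adj_mult_pinv: "adj (a * pinv a) = a * pinv a"
  and adj_pinv_mult: "adj (pinv a * a) = pinv a * a"
  using is_pinv_pinv[of a] by (simp_all add: is_pinv_def mult_assoc)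

text \<open>Replacing \<open>a * pinv a\<close> by its adjoint in the outer identity exhibits
  \<open>adj a\<close> as a right factor of \<open>pinv a\<close>; \<open>pinv_right\<close> is the
  mirror image. So whatever \<open>adj a\<close> annihilates, \<open>pinv a\<close> annihilates too,
  and \<open>pinv a\<close> inherits the row and column ranges of \<open>adj a\<close>.\<close>

lemma pinv_left: "pinv a = pinv a * adj (pinv a) * adj a"
  by (metis adj_mult adj_mult_pinv pinv_outer mult_assoc)

lemma pinv_right: "pinv a = adj a * adj (pinv a) * pinv a"
  by (metis adj_mult adj_pinv_mult pinv_outer mult_assoc)

lemma pinv_mult_eq_0: "adj a * x = 0 \<Longrightarrow> pinv a * x = 0"
  by (metis pinv_left mult_assoc mult_zero_right)

lemma mult_pinv_eq_0: "x * adj a = 0 \<Longrightarrow> x * pinv a = 0"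
  by (metis pinv_right mult_assoc mult_zero_left)

end

subsection \<open>The generalized Sylvester equation in a *-regular ring\<close>

text \<open>
  As there is no unit, \<open>\<L>\<close> and \<open>\<R>\<close> appear through their action:
  \<open>\<R>\<^bsub>a\<^esub> c = c - a a\<^sup>\<dagger> c\<close> and \<open>d \<L>\<^bsub>b\<^esub> = d - d b\<^sup>\<dagger> b\<close>.
\<close>

locale sylvester =
  fixes a b c d p q s :: "'a :: star_regular_ring"
  assumes p_def: "p = c - a * pinv a * c"
    and q_def: "q = d - d * pinv b * b"
    and s_def: "s = c - c * pinv p * p"
begin

section \<open>Annihilation and absorption relations between the coefficients\<close>

lemma pinv_p_a: "pinv p * a = 0"
proof (rule pinv_mult_eq_0)
  \<comment> \<open>As \<open>a * pinv a\<close> is self-adjoint, \<R> for \<open>a\<close> moves to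
    the right of \<open>adj c\<close> when adjoints are taken, where it kills
    \<open>a\<close>.\<close>
  have "adj p = adj c - adj c * (a * pinv a)"
    by (simp only: p_def adj_diff adj_mult[of "a * pinv a" c] adj_mult_pinv)
  then show "adj p * a = 0"
    by (simp add: left_diff_distrib mult.assoc pinv_inner)
qed

lemma b_pinv_q: "b * pinv q = 0"
proof (rule mult_pinv_eq_0)
  have "adj q = adj d - pinv b * b * adj d"
    by (simp only: q_def mult.assoc[of d] adj_diff adj_mult[of d] adj_pinv_mult)
  then have "b * adj q = b * adj d - b * (pinv b * b) * adj d"
    by (simp only: right_diff_distrib mult.assoc)
  then show "b * adj q = 0"
    by (simp add: pinv_inner)
qed

lemma s_pinv_p: "s * pinv p = 0"
  by (simp add: s_def left_diff_distrib mult.assoc pinv_outer)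

text \<open>Since \<open>adj p = pinv p * p * adj p\<close>, the relation
  \<open>s * pinv p = 0\<close> gives \<open>s * adj p = 0\<close>. The adjoint
  \<open>p * adj s = 0\<close> of this passes to \<open>pinv s\<close>.\<close>

lemma p_pinv_s: "p * pinv s = 0"
proof (rule mult_pinv_eq_0)
  have "s * adj p = s * pinv p * p * adj p"
    by (metis adj_mult adj_pinv_mult pinv_inner mult.assoc)
  then have "s * adj p = 0"
    by (simp add: s_pinv_p)
  then show "p * adj s = 0"
    by (metis adj_0 adj_adj adj_mult)
qed

text \<open>\<open>p\<close> and \<open>c\<close> differ by a left multiple of \<open>a\<close>,
  which \<open>pinv p\<close> kills. The next two lemmas exchange \<open>d\<close> with
  \<open>q\<close> and \<open>c\<close> with \<open>s\<close> in the same way.\<close>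

lemma pinv_p_c: "pinv p * c = pinv p * p"
proof -
  have "pinv p * p = pinv p * c - pinv p * a * (pinv a * c)"
    by (simp add: p_def algebra_simps)
  then show ?thesis by (simp add: pinv_p_a)
qed

lemma d_pinv_q: "d * pinv q = q * pinv q"
proof -
  have "q * pinv q = d * pinv q - d * pinv b * (b * pinv q)"
    by (simp add: q_def algebra_simps)
  then show ?thesis by (simp add: b_pinv_q)
qed

lemma c_pinv_s: "c * pinv s = s * pinv s"
proof -
  have "s * pinv s = c * pinv s - c * pinv p * (p * pinv s)"
    by (simp add: s_def algebra_simps)
  then show ?thesis by (simp add: p_pinv_s)
qed

text \<open>Applying \<R> for \<open>a\<close> to \<open>s\<close> gives
  \<open>p - p * pinv p * p = 0\<close>, so \<open>s\<close> lies in the right ideal generated by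
  \<open>a\<close>. This is why a change of \<open>y\<close> that acts through \<open>s\<close> can
  be compensated by \<open>x\<close>.\<close>

lemma a_pinv_a_s: "a * pinv a * s = s"
proof -
  have "s - a * pinv a * s = p - p * (pinv p * p)"
  proof -
    have "p * (pinv p * p) = c * (pinv p * p) - a * pinv a * c * (pinv p * p)"
      by (simp add: p_def[symmetric] left_diff_distrib[symmetric])
    then show ?thesis
      by (simp add: s_def p_def algebra_simps)
  qed
  then show ?thesis by (simp add: pinv_inner)
qed


lemma a_pinv_a_c: "a * pinv a * c = c - p"
  by (simp add: p_def)

lemma d_pinv_b_b: "d * pinv b * b = d - q"
  by (simp add: q_def)

lemma c_pinv_p_p: "c * pinv p * p = c - s"
  by (simp add: s_def)

section \<open>Necessity of the four conditions\<close>

lemma consistent_imp_conditions: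
  assumes e: "a * x * b + c * y * d = e"
  shows "p * pinv p * e = e - a * pinv a * e"
    and "e * pinv q * q = e - e * pinv b * b"
    and "(e - a * pinv a * e) * (pinv d * d) = e - a * pinv a * e"
    and "(c * pinv c) * (e - e * pinv b * b) = e - e * pinv b * b"
proof -
  \<comment> \<open>Multiplying \<open>e\<close> by \<R> for \<open>a\<close>, or by \<L> for
    \<open>b\<close>, removes the term in \<open>x\<close>. The four conditions then reduce to the
    inner identities of \<open>p\<close>, \<open>q\<close>, \<open>d\<close> and \<open>c\<close>,
    in this order.\<close>
  have ae: "e - a * pinv a * e = p * y * d"
    using arg_cong[OF pinv_inner[of a], of "\<lambda>t. t * x * b"]
    by (simp add: e[symmetric] p_def algebra_simps)
  have eb: "e - e * pinv b * b = c * y * q"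
    by (simp add: e[symmetric] q_def algebra_simps pinv_inner)
  have "p * pinv p * e = p * (pinv p * a) * x * b + p * (pinv p * c) * y * d"
    by (simp add: e[symmetric] algebra_simps)
  then show "p * pinv p * e = e - a * pinv a * e"
    by (simp add: pinv_p_a pinv_p_c pinv_inner ae)
  have "e * pinv q * q = a * x * (b * pinv q) * q + c * y * (d * pinv q) * q"
    by (simp add: e[symmetric] algebra_simps)
  then have "e * pinv q * q = c * y * (q * (pinv q * q))"
    by (simp add: b_pinv_q d_pinv_q mult.assoc)
  then show "e * pinv q * q = e - e * pinv b * b"
    by (simp add: pinv_inner eb)
  show "(e - a * pinv a * e) * (pinv d * d) = e - a * pinv a * e"
    unfolding ae by (simp add: mult.assoc pinv_inner)
  have "(c * pinv c) * (c * y * q) = c * (pinv c * c) * y * q"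
    by (simp add: mult.assoc)
  then show "(c * pinv c) * (e - e * pinv b * b) = e - e * pinv b * b"
    by (simp add: eb pinv_inner)
qed

section \<open>The solution formulas: sufficiency and completeness\<close>

definition sol_x :: "'a \<Rightarrow> 'a \<Rightarrow> 'a \<Rightarrow> 'a \<Rightarrow> 'a" where
  "sol_x e u2 u4 u5 =
     pinv a * e * pinv b - pinv a * c * pinv p * e * pinv b
     - pinv a * s * pinv c * e * pinv q * d * pinv b
     - pinv a * s * (u2 - u2 * q * pinv q) * d * pinv b
     + (u4 - pinv a * a * u4) + (u5 - u5 * b * pinv b)"

text \<open>The last three lines are \<L> of \<open>p\<close> times \<L> of \<open>s\<close> times
  \<open>u1\<close>, then \<L> of \<open>p\<close> times \<open>u2\<close> times \<R> of
  \<open>q\<close>, then \<open>u3\<close> times \<R> of \<open>d\<close>, all multiplied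
  out.\<close>

definition sol_y :: "'a \<Rightarrow> 'a \<Rightarrow> 'a \<Rightarrow> 'a \<Rightarrow> 'a" where
  "sol_y e u1 u2 u3 =
     pinv p * e * pinv d + pinv s * s * pinv c * e * pinv q
     + (u1 - pinv s * s * u1 - pinv p * p * (u1 - pinv s * s * u1))
     + (u2 - pinv p * p * u2 - (u2 - pinv p * p * u2) * q * pinv q)
     + (u3 - u3 * d * pinv d)"

text \<open>The terms with \<open>u1\<close>, \<open>u3\<close>, \<open>u4\<close>,
  \<open>u5\<close> are annihilated. Those with \<open>u2\<close> contribute
  \<open>s * ?v * d\<close> to both summands with opposite signs, and so does \<open>?w * d\<close>.
  What is left adds up to \<open>e\<close> by the four conditions.\<close>

lemma sol_solves:
  assumes k1: "p * pinv p * e = e - a * pinv a * e"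
    and k2: "e * pinv q * q = e - e * pinv b * b"
    and k3: "(e - a * pinv a * e) * (pinv d * d) = e - a * pinv a * e"
    and k4: "(c * pinv c) * (e - e * pinv b * b) = e - e * pinv b * b"
  shows "a * sol_x e u2 u4 u5 * b + c * sol_y e u1 u2 u3 * d = e"
proof -
  let ?v = "u2 - u2 * q * pinv q"
  let ?w = "s * pinv c * e * pinv q"
  have dbb: "d * (pinv b * b) = d - q"
    using d_pinv_b_b by (simp add: mult.assoc)
  have "a * (u4 - pinv a * a * u4) = 0"
    by (simp add: right_diff_distrib mult.assoc[symmetric]) (simp add: mult.assoc pinv_inner)
  moreover have "(u5 - u5 * b * pinv b) * b = 0"
    by (simp add: left_diff_distrib mult.assoc pinv_inner)
  ultimately have "a * sol_x e u2 u4 u5 * b =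
      a * pinv a * e * pinv b * b - a * pinv a * c * pinv p * e * pinv b * b
      - (a * pinv a * s) * pinv c * e * pinv q * (d * (pinv b * b))
      - (a * pinv a * s) * ?v * (d * (pinv b * b))"
    unfolding sol_x_def
    by (simp add: distrib_left distrib_right mult.assoc) (simp add: algebra_simps)
  also have "(a * pinv a * s) * ?v * (d * (pinv b * b)) = s * ?v * d"
  proof -
    have "?v * q = 0"
      by (simp add: left_diff_distrib mult.assoc pinv_inner)
    then have "s * ?v * q = 0"
      by (simp only: mult.assoc mult_zero_right)
    then show ?thesis
      by (simp only: a_pinv_a_s dbb right_diff_distrib[of _ d q] diff_zero)
  qed
  also have "(a * pinv a * s) * pinv c * e * pinv q * (d * (pinv b * b)) = ?w * d - ?w * q"
    by (simp add: a_pinv_a_s dbb right_diff_distrib)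
  finally have ax: "a * sol_x e u2 u4 u5 * b =
      a * pinv a * e * pinv b * b - a * pinv a * c * pinv p * e * pinv b * b
      - (?w * d - ?w * q) - s * ?v * d" .

  have "c * pinv s * s = s"
    by (simp add: c_pinv_s mult.assoc pinv_inner)
  moreover have "c * (u1 - pinv s * s * u1 - pinv p * p * (u1 - pinv s * s * u1)) = 0"
  proof -
    have "c * (u - pinv p * p * u) = s * u" for u
      by (simp add: s_def algebra_simps)
    moreover have "s * (u1 - pinv s * s * u1) = 0"
      by (simp add: right_diff_distrib mult.assoc[symmetric]) (simp add: mult.assoc pinv_inner)
    ultimately show ?thesis by simp
  qed
  moreover have "c * (u2 - pinv p * p * u2 - (u2 - pinv p * p * u2) * q * pinv q) = s * ?v"
    by (simp add: s_def algebra_simps)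
  moreover have "(u3 - u3 * d * pinv d) * d = 0"
    by (simp add: left_diff_distrib mult.assoc pinv_inner)
  moreover have "c * sol_y e u1 u2 u3 * d = c * pinv p * e * (pinv d * d)
      + (c * pinv s * s) * pinv c * e * pinv q * d
      + c * (u1 - pinv s * s * u1 - pinv p * p * (u1 - pinv s * s * u1)) * d
      + c * (u2 - pinv p * p * u2 - (u2 - pinv p * p * u2) * q * pinv q) * d
      + c * ((u3 - u3 * d * pinv d) * d)"
    unfolding sol_y_def by (simp only: distrib_left distrib_right mult.assoc)
  ultimately have "c * sol_y e u1 u2 u3 * d = c * pinv p * e * (pinv d * d) + ?w * d + s * ?v * d"
    by simp
  \<comment> \<open>The third condition enters here: multiplied by \<open>pinv p\<close> from the
    left, it loses the terms beginning with \<open>a\<close>.\<close>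
  moreover have "pinv p * e * (pinv d * d) = pinv p * e"
  proof -
    have "pinv p * (e - a * pinv a * e) = pinv p * e - (pinv p * a) * pinv a * e"
      by (simp add: algebra_simps)
    then show ?thesis
      using arg_cong[OF k3, of "\<lambda>t. pinv p * t"] by (simp add: pinv_p_a mult.assoc[symmetric])
  qed
  ultimately have cy: "c * sol_y e u1 u2 u3 * d = c * pinv p * e + ?w * d + s * ?v * d"
    by (simp add: mult.assoc)

  \<comment> \<open>The second condition turns \<open>e * pinv q * q\<close> into \<open>?f\<close>;
    then \<open>pinv p * p = pinv p * c\<close> creates the product \<open>c * pinv c * ?f\<close>,
    which the fourth condition reduces to \<open>?f\<close>.\<close>
  have wq: "?w * q = e - e * pinv b * b - c * pinv p * (e - e * pinv b * b)"
  proof -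
    let ?f = "e - e * pinv b * b"
    have "?w * q = s * pinv c * ?f"
      using k2 by (simp add: mult.assoc)
    also have "\<dots> = c * pinv c * ?f - c * (pinv p * p) * (pinv c * ?f)"
      by (simp only: s_def left_diff_distrib mult.assoc)
    also have "\<dots> = c * pinv c * ?f - c * pinv p * (c * pinv c * ?f)"
      by (simp only: pinv_p_c[symmetric] mult.assoc)
    finally show ?thesis by (simp only: k4)
  qed
  \<comment> \<open>By the definition of \<open>p\<close> the left side is
    \<open>(c - p) * pinv p * e\<close>, and the first condition evaluates
    \<open>p * pinv p * e\<close>.\<close>
  have "a * pinv a * c * pinv p * e = c * pinv p * e - (e - a * pinv a * e)"
    by (simp add: a_pinv_a_c left_diff_distrib k1)
  then have "a * pinv a * c * pinv p * e * pinv b * b =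
      c * pinv p * e * pinv b * b - e * pinv b * b + a * pinv a * e * pinv b * b"
    by (simp add: left_diff_distrib)
  then show ?thesis
    unfolding ax cy wq by (simp add: right_diff_distrib mult.assoc)
qed

text \<open>The formula for \<open>y\<close> is built on the splitting of \<open>y\<close> into
  \<open>pinv p * p * y\<close>, \<open>pinv s * s * y\<close> and the rest. In the first two parts
  the terms with \<open>e\<close> supply the piece multiplied by \<open>d * pinv d\<close> or
  \<open>q * pinv q\<close>, and \<open>u3\<close>, \<open>u2\<close> supply the complementary
  piece; \<open>u1 = y\<close> supplies the rest. For \<open>x\<close>, the terms with
  \<open>y\<close> cancel, and the others add up to \<open>x\<close>.\<close>

lemma sol_complete:
  assumes e: "a * x * b + c * y * d = e"
  shows "x = sol_x e (pinv s * s * y) x (pinv a * a * x)"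
    and "y = sol_y e y (pinv s * s * y) (pinv p * p * y)"
proof -
  have ps: "p * pinv s * s = 0"
    by (simp add: p_pinv_s)
  have pe: "pinv p * e = pinv p * p * y * d"
  proof -
    have "pinv p * e = (pinv p * a) * x * b + (pinv p * c) * y * d"
      by (simp add: e[symmetric] algebra_simps)
    then show ?thesis by (simp add: pinv_p_a pinv_p_c)
  qed
  have eq: "e * pinv q = c * y * q * pinv q"
  proof -
    have "e * pinv q = a * x * (b * pinv q) + c * y * (d * pinv q)"
      by (simp add: e[symmetric] algebra_simps)
    then show ?thesis by (simp add: b_pinv_q d_pinv_q mult.assoc)
  qed
  \<comment> \<open>By \<open>pinv_p_c\<close>, \<open>s = c - c * pinv p * c\<close>; both terms
    end in \<open>c\<close> and absorb \<open>pinv c * c\<close>.\<close>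
  have scc: "s * pinv c * c = s"
  proof -
    have "s * pinv c * c = c * (pinv c * c) - c * (pinv p * c) * (pinv c * c)"
      by (simp only: s_def pinv_p_c left_diff_distrib mult.assoc)
    also have "\<dots> = c - c * pinv p * c"
      by (simp only: mult.assoc pinv_inner)
    also have "\<dots> = s"
      by (simp add: s_def mult.assoc pinv_p_c)
    finally show ?thesis .
  qed
  have sce: "s * pinv c * e * pinv q = s * y * q * pinv q"
  proof -
    have "s * pinv c * e * pinv q = s * pinv c * (e * pinv q)" by (simp add: mult.assoc)
    also have "\<dots> = (s * pinv c * c) * y * q * pinv q" by (simp only: eq mult.assoc)
    finally show ?thesis by (simp only: scc)
  qed
  have sss: "s * (pinv s * s * y) = s * y"
    using pinv_inner[of s] by (metis mult.assoc)
  show "y = sol_y e y (pinv s * s * y) (pinv p * p * y)"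
  proof -
    have "pinv p * e * pinv d = pinv p * p * y * d * pinv d"
      by (simp only: pe)
    moreover have "pinv s * s * pinv c * e * pinv q = pinv s * s * y * q * pinv q"
      using arg_cong[OF sce, of "\<lambda>t. pinv s * t"] by (simp only: mult.assoc)
    moreover have "pinv p * p * (pinv s * s * y) = 0"
      using arg_cong[OF ps, of "\<lambda>t. pinv p * t * y"] by (simp add: mult.assoc)
    ultimately show ?thesis
      by (simp add: sol_y_def right_diff_distrib left_diff_distrib)
  qed
  show "x = sol_x e (pinv s * s * y) x (pinv a * a * x)"
  proof -
    have 1: "pinv a * c * pinv p * e * pinv b = pinv a * (c * pinv p * p) * y * d * pinv b"
      using arg_cong[OF pe, of "\<lambda>t. pinv a * c * t * pinv b"] by (simp only: mult.assoc)
    have 2: "pinv a * s * pinv c * e * pinv q * d * pinv b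
        = pinv a * s * y * q * pinv q * d * pinv b"
      using arg_cong[OF sce, of "\<lambda>t. pinv a * t * d * pinv b"] by (simp only: mult.assoc)
    have 3: "pinv a * s * (pinv s * s * y - pinv s * s * y * q * pinv q) * d * pinv b
        = pinv a * s * y * d * pinv b - pinv a * s * y * q * pinv q * d * pinv b"
      using arg_cong[OF sss, of "\<lambda>t. pinv a * t * d * pinv b"]
        arg_cong[OF sss, of "\<lambda>t. pinv a * t * q * pinv q * d * pinv b"]
      by (simp only: mult.assoc right_diff_distrib left_diff_distrib)
    have 4: "pinv a * e * pinv b = pinv a * a * x * b * pinv b + pinv a * c * y * d * pinv b"
      by (simp add: e[symmetric] distrib_left distrib_right mult.assoc)
    show ?thesis
      unfolding sol_x_def 1 2 3 4 c_pinv_p_p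
      by (simp add: right_diff_distrib left_diff_distrib)
  qed
qed

end

subsection \<open>Finitely supported quaternion matrices\<close>

lemma qcnj_simps [simp]:
  "qcnj 0 = 0" "qcnj (qcnj x) = x"
  "qcnj (x + y) = qcnj x + qcnj y" "qcnj (x * y) = qcnj y * qcnj x"
  by (simp_all add: quaternion_eq_iff qcnj_def zero_quaternion_def
      plus_quaternion_def times_quaternion_def algebra_simps)

lemma qcnj_sum: "qcnj (sum f S) = (\<Sum>i\<in>S. qcnj (f i))"
  by (induction S rule: infinite_finite_induct) simp_all

lemma q0_sum: "q0 (sum f S) = (\<Sum>i\<in>S. q0 (f i))"
  by (induction S rule: infinite_finite_induct) (simp_all add: zero_quaternion_def plus_quaternion_def)

lemma q0_qcnj_mult_self: "q0 (qcnj x * x) = (q0 x)\<^sup>2 + (q1 x)\<^sup>2 + (q2 x)\<^sup>2 + (q3 x)\<^sup>2"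
  by (simp add: qcnj_def times_quaternion_def power2_eq_square)

lemma q0_qcnj_mult_self_nonneg: "0 \<le> q0 (qcnj x * x)"
  by (simp add: q0_qcnj_mult_self)

lemma q0_qcnj_mult_self_eq_0_iff: "q0 (qcnj x * x) = 0 \<longleftrightarrow> x = 0"
  by (simp add: q0_qcnj_mult_self quaternion_eq_iff zero_quaternion_def add_nonneg_eq_0_iff)

lemma quaternion_right_inverse:
  fixes x :: quaternion
  assumes "x \<noteq> 0"
  shows "\<exists>y. x * y = 1"
proof -
  define n where "n = q0 (qcnj x * x)"
  have n: "n \<noteq> 0"
    using assms by (simp add: n_def q0_qcnj_mult_self_eq_0_iff)
  \<comment> \<open>The witness is the conjugate of \<open>x\<close> divided by the squared norm
    \<open>n\<close>.\<close>
  have "x * Quat (q0 x / n) (- q1 x / n) (- q2 x / n) (- q3 x / n) = 1"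
    using n by (simp add: times_quaternion_def one_quaternion_def field_simps)
      (simp add: n_def q0_qcnj_mult_self power2_eq_square)
  then show ?thesis ..
qed

section \<open>The ring of finitely supported matrices\<close>

typedef 'i qmat = "{f :: 'i \<Rightarrow> 'i \<Rightarrow> quaternion. finite {i. \<exists>j. f i j \<noteq> 0 \<or> f j i \<noteq> 0}}"
  morphisms coef Abs_qmat
  by (rule exI[of _ "\<lambda>_ _. 0"]) simp

text \<open>Rows and columns are collected in one set, so that a single finite set bounds both
  indices and the involution leaves it unchanged.\<close>

definition supp :: "'i qmat \<Rightarrow> 'i set" where
  "supp a = {i. \<exists>j. coef a i j \<noteq> 0 \<or> coef a j i \<noteq> 0}"

lemma finite_supp [simp]: "finite (supp a)"
  using coef[of a] by (simp add: supp_def)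

lemma coef_eq_0: "i \<notin> supp a \<Longrightarrow> coef a i j = 0" "j \<notin> supp a \<Longrightarrow> coef a i j = 0"
  by (auto simp: supp_def)

lemma qmat_eqI: "(\<And>i j. coef a i j = coef b i j) \<Longrightarrow> a = b"
  by (metis coef_inject ext)

lemma coef_Abs_qmat:
  assumes "finite S" and "\<And>i j. i \<notin> S \<or> j \<notin> S \<Longrightarrow> f i j = 0"
  shows "coef (Abs_qmat f) = f"
proof -
  have "{i. \<exists>j. f i j \<noteq> 0 \<or> f j i \<noteq> 0} \<subseteq> S"
    using assms(2) by auto
  then show ?thesis
    using assms(1) by (intro Abs_qmat_inverse) (auto intro: finite_subset)
qed

instantiation qmat :: (type) "{ring}"
begin

definition "0 = Abs_qmat (\<lambda>_ _. 0)"
definition "a + b = Abs_qmat (\<lambda>i j. coef a i j + coef b i j)"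
definition "a - b = Abs_qmat (\<lambda>i j. coef a i j - coef b i j)"
definition "- a = Abs_qmat (\<lambda>i j. - coef a i j)"
definition "a * b = Abs_qmat (\<lambda>i k. \<Sum>j\<in>supp a. coef a i j * coef b j k)"

lemma coef_0 [simp]: "coef 0 i j = 0"
  unfolding zero_qmat_def by (subst coef_Abs_qmat[of "{}"]) simp_all

lemma coef_add [simp]: "coef (a + b) i j = coef a i j + coef b i j"
  unfolding plus_qmat_def
  by (subst coef_Abs_qmat[of "supp a \<union> supp b"]) (auto simp: coef_eq_0)

lemma coef_diff [simp]: "coef (a - b) i j = coef a i j - coef b i j"
  unfolding minus_qmat_def
  by (subst coef_Abs_qmat[of "supp a \<union> supp b"]) (auto simp: coef_eq_0)

lemma coef_uminus [simp]: "coef (- a) i j = - coef a i j"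
  unfolding uminus_qmat_def
  by (subst coef_Abs_qmat[of "supp a"]) (auto simp: coef_eq_0)

lemma coef_mult_supp: "coef (a * b) i k = (\<Sum>j\<in>supp a. coef a i j * coef b j k)"
  unfolding times_qmat_def
  by (subst coef_Abs_qmat[of "supp a \<union> supp b"]) (auto simp: coef_eq_0)

lemma supp_mult: "supp (a * b) \<subseteq> supp a \<union> supp b"
proof
  fix i
  assume "i \<in> supp (a * b)"
  moreover have "coef (a * b) i j = 0 \<and> coef (a * b) j i = 0" if "i \<notin> supp a \<union> supp b" for j
    using that by (simp add: coef_mult_supp coef_eq_0)
  ultimately show "i \<in> supp a \<union> supp b"
    by (auto simp: supp_def[of "a * b"])
qed

text \<open>Enlarging the summation range adds only zeros. All sums in a ring axiom can thus run
  over one common set, and associativity becomes an exchange of two finite sums.\<close>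

lemma coef_mult:
  assumes "finite S" and "supp a \<subseteq> S"
  shows "coef (a * b) i k = (\<Sum>j\<in>S. coef a i j * coef b j k)"
  unfolding coef_mult_supp using assms
  by (intro sum.mono_neutral_left) (auto simp: coef_eq_0)

instance
proof
  fix a b c :: "'a qmat"
  define S where "S = supp a \<union> supp b \<union> supp c"
  have S: "finite S" "supp a \<subseteq> S" "supp b \<subseteq> S" "supp c \<subseteq> S"
    by (auto simp: S_def)
  have ab: "supp (a + b) \<subseteq> S"
    by (auto simp: S_def supp_def)
  have mab: "supp (a * b) \<subseteq> S"
    using supp_mult[of a b] by (auto simp: S_def)
  show "a * b * c = a * (b * c)"
  proof (rule qmat_eqI)
    fix i k
    have "coef (a * b * c) i k = (\<Sum>j\<in>S. \<Sum>l\<in>S. coef a i l * coef b l j * coef c j k)"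
      by (simp add: coef_mult[OF S(1)] S mab sum_distrib_right)
    also have "\<dots> = (\<Sum>l\<in>S. \<Sum>j\<in>S. coef a i l * coef b l j * coef c j k)"
      by (rule sum.swap)
    also have "\<dots> = coef (a * (b * c)) i k"
      by (simp add: coef_mult[OF S(1)] S sum_distrib_left mult.assoc)
    finally show "coef (a * b * c) i k = coef (a * (b * c)) i k" .
  qed
  show "(a + b) * c = a * c + b * c"
    by (rule qmat_eqI) (simp add: coef_mult[OF S(1)] S ab distrib_right sum.distrib)
  show "a * (b + c) = a * b + a * c"
    by (rule qmat_eqI) (simp add: coef_mult[OF S(1)] S distrib_left sum.distrib)
qed (auto intro!: qmat_eqI)

end

section \<open>Von Neumann regularity of the matrix ring\<close>

lemma coef_single:
  "coef (Abs_qmat (\<lambda>i j. if i = q \<and> j = p then x else 0)) i j = (if i = q \<and> j = p then x else 0)"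
proof (subst coef_Abs_qmat[of "{p, q}"])
  show "(if i = q \<and> j = p then x else 0) = 0" if "i \<notin> {p, q} \<or> j \<notin> {p, q}" for i j
    by (rule if_not_P) (use that in blast)
qed simp_all

text \<open>McCoy's lemma. The witness is \<open>u + (1 - u * a) * g * (1 - a * u)\<close>,
  multiplied out because the ring has no unit.\<close>

lemma regular_if_diff_regular:
  fixes a :: "'a::ring"
  assumes "(a - a * u * a) * g * (a - a * u * a) = a - a * u * a"
  shows "\<exists>y. a * y * a = a"
proof -
  have "a * (u + g - u * a * g - g * a * u + u * a * g * a * u) * a
      = a * u * a + (a - a * u * a) * g * (a - a * u * a)"
    by (simp add: algebra_simps)
  also have "\<dots> = a"
    unfolding assms by simp
  finally show ?thesis ..
qed

text \<open>Gaussian elimination, by induction on the number of nonzero rows. For a pivot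
  \<open>coef a p q\<close> with right inverse \<beta>, let \<open>u\<close> have the single entry
  \<beta> at \<open>(q, p)\<close>. Then \<open>a * u * a\<close> is column \<open>q\<close> times
  \<beta> times row \<open>p\<close>; subtracting it from \<open>a\<close> clears row
  \<open>p\<close> and keeps zero rows zero.\<close>

lemma qmat_regular:
  fixes a :: "'i qmat"
  shows "\<exists>y. a * y * a = a"
proof (induction "card {i. \<exists>j. coef a i j \<noteq> 0}" arbitrary: a rule: less_induct)
  case less
  let ?rows = "\<lambda>a :: 'i qmat. {i. \<exists>j. coef a i j \<noteq> 0}"
  show ?case
  proof (cases "a = 0")
    case False
    have "\<exists>p q. coef a p q \<noteq> 0"
    proof (rule ccontr)
      assume "\<not> ?thesis"
      then have "a = 0"
        by (intro qmat_eqI) simp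
      with False show False ..
    qed
    then obtain p q where pq: "coef a p q \<noteq> 0"
      by (elim exE)
    obtain \<beta> where \<beta>: "coef a p q * \<beta> = 1"
      using quaternion_right_inverse[OF pq] by (elim exE)
    define u where "u = Abs_qmat (\<lambda>i j. if i = q \<and> j = p then \<beta> else 0)"
    have u: "coef u i j = (if i = q \<and> j = p then \<beta> else 0)" for i j
      unfolding u_def by (rule coef_single)
    have supp_u: "supp u \<subseteq> {p, q}"
    proof
      fix i
      assume "i \<in> supp u"
      then obtain j where "coef u i j \<noteq> 0 \<or> coef u j i \<noteq> 0"
        unfolding supp_def by blast
      then show "i \<in> {p, q}"
        unfolding u by (metis insertCI)
    qed
    have ua: "coef (u * a) i k = (if i = q then \<beta> * coef a p k else 0)" for i k
    proof -
      have "coef (u * a) i k = (\<Sum>j\<in>{p, q}. coef u i j * coef a j k)"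
        by (rule coef_mult[OF _ supp_u]) simp
      also have "\<dots> = (\<Sum>j\<in>{p, q}. if j = p then coef u i p * coef a p k else 0)"
        by (intro sum.cong refl) (simp add: u)
      finally show ?thesis by (simp add: u)
    qed
    have aua: "coef (a * u * a) i k = coef a i q * \<beta> * coef a p k" for i k
    proof -
      have q: "q \<in> supp a"
        using pq by (auto simp: supp_def)
      have "coef (a * u * a) i k = (\<Sum>j\<in>supp a. coef a i j * coef (u * a) j k)"
        unfolding mult.assoc[of a] by (rule coef_mult_supp)
      also have "\<dots> = (\<Sum>j\<in>supp a. if j = q then coef a i q * \<beta> * coef a p k else 0)"
        by (intro sum.cong refl) (simp add: ua mult.assoc)
      finally show ?thesis
        using q by simp
    qed
    have "coef (a - a * u * a) i j = 0" if "\<And>j. coef a i j = 0" for i j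
      by (simp add: aua that)
    then have "?rows (a - a * u * a) \<subseteq> ?rows a"
      by blast
    moreover have "p \<notin> ?rows (a - a * u * a)"
      by (simp add: aua \<beta>)
    moreover have "p \<in> ?rows a"
      using pq by blast
    moreover have "finite (?rows a)"
      by (rule finite_subset[OF _ finite_supp[of a]]) (auto simp: supp_def)
    ultimately have "card (?rows (a - a * u * a)) < card (?rows a)"
      by (intro psubset_card_mono) blast+
    from less(1)[OF this]
    obtain g where "(a - a * u * a) * g * (a - a * u * a) = a - a * u * a"
      by (elim exE)
    then show ?thesis
      by (rule regular_if_diff_regular)
  qed auto
qed

section \<open>The proper involution on matrices\<close>

instantiation qmat :: (type) star_regular_ring
begin

definition "adj a = Abs_qmat (\<lambda>i j. qcnj (coef a j i))"

lemma coef_adj [simp]: "coef (adj a) i j = qcnj (coef a j i)"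
  unfolding adj_qmat_def
  by (subst coef_Abs_qmat[of "supp a"]) (auto simp: coef_eq_0)

instance
proof
  fix a b :: "'a qmat"
  have qcnj_eq_0: "qcnj x = 0 \<longleftrightarrow> x = 0" for x
    by (metis qcnj_simps(1,2))
  have supp_adj: "supp (adj a) = supp a" for a :: "'a qmat"
    by (auto simp: supp_def qcnj_eq_0)
  show "adj (a + b) = adj a + adj b"
    by (rule qmat_eqI) simp
  show "adj (adj a) = a"
    by (rule qmat_eqI) simp
  have S: "finite (supp a \<union> supp b)" by simp
  show "adj (a * b) = adj b * adj a"
    by (rule qmat_eqI) (simp add: coef_mult[OF S] supp_adj qcnj_sum)
  show "\<exists>y. a * y * a = a"
    by (rule qmat_regular)
  show "a = 0" if "adj a * a = 0"
  proof (rule qmat_eqI)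
    fix i j
    \<comment> \<open>The real part of the diagonal entry \<open>(j, j)\<close> of
      \<open>adj a * a\<close> is the sum of the squared norms in column \<open>j\<close> of
      \<open>a\<close>.\<close>
    have "(\<Sum>i\<in>supp a. q0 (qcnj (coef a i j) * coef a i j)) = q0 (coef (adj a * a) j j)"
      by (simp add: coef_mult_supp supp_adj q0_sum)
    also have "\<dots> = 0"
      by (simp add: that zero_quaternion_def)
    finally have "\<forall>i\<in>supp a. q0 (qcnj (coef a i j) * coef a i j) = 0"
      by (subst (asm) sum_nonneg_eq_0_iff) (auto simp: q0_qcnj_mult_self_nonneg)
    then show "coef a i j = coef 0 i j"
      by (cases "i \<in> supp a") (auto simp: q0_qcnj_mult_self_eq_0_iff coef_eq_0)
  qed
qed

end

subsection \<open>Tensors as matrices indexed by multi-indices\<close>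

lemma multi_indices_length: "i \<in> multi_indices I \<Longrightarrow> length i = length I"
  by (auto simp: multi_indices_def dest: list_all2_lengthD)

lemma multi_indices_append_iff:
  "length i = length I \<Longrightarrow> i @ j \<in> multi_indices (I @ J) \<longleftrightarrow> i \<in> multi_indices I \<and> j \<in> multi_indices J"
  by (simp add: multi_indices_def list_all2_append)

lemma multi_indices_appendE:
  assumes "ix \<in> multi_indices (I @ J)"
  obtains i j where "ix = i @ j" "i \<in> multi_indices I" "j \<in> multi_indices J"
proof -
  have "length ix = length I + length J"
    using multi_indices_length[OF assms] by simp
  then have "length (take (length I) ix) = length I"
    by simp
  then show ?thesis
    using that assms multi_indices_append_iff by (metis append_take_drop_id)
qed

lemma finite_multi_indices [simp]: "finite (multi_indices I)"
proof (rule finite_subset)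
  show "multi_indices I \<subseteq> {ix. set ix \<subseteq> {..Max (set I)} \<and> length ix = length I}"
  proof clarify
    fix ix
    assume ix: "ix \<in> multi_indices I"
    have "x \<le> Max (set I)" if x: "x \<in> set ix" for x
    proof -
      obtain k where k: "k < length ix" "x = ix ! k"
        using x by (metis in_set_conv_nth)
      moreover have "ix ! k \<le> I ! k" "k < length I"
        using ix k by (auto simp: multi_indices_def list_all2_conv_all_nth)
      ultimately show ?thesis
        by (metis List.finite_set Max_ge nth_mem order_trans)
    qed
    then show "set ix \<subseteq> {..Max (set I)} \<and> length ix = length I"
      using multi_indices_length[OF ix] by auto
  qed
qed (rule finite_lists_length_eq, simp)

text \<open>The unfolding of a tensor into a matrix, padded by zeros. The split of the mode sizes
  into \<open>I\<close> and \<open>J\<close> is an argument because the tensor itself does not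
  determine it.\<close>

definition rep :: "nat list \<Rightarrow> nat list \<Rightarrow> tensor \<Rightarrow> nat list qmat \<Rightarrow> bool" where
  "rep I J A a \<longleftrightarrow> A \<in> tensors (I @ J) \<and>
     (\<forall>i j. coef a i j = (if i \<in> multi_indices I \<and> j \<in> multi_indices J then entry A (i @ j) else 0))"

lemma rep_tensors: "rep I J A a \<Longrightarrow> A \<in> tensors (I @ J)"
  by (simp add: rep_def)

lemma rep_coef:
  "rep I J A a \<Longrightarrow>
    coef a i j = (if i \<in> multi_indices I \<and> j \<in> multi_indices J then entry A (i @ j) else 0)"
  by (simp add: rep_def)

lemma repI:
  assumes "A \<in> tensors (I @ J)"
    and "\<And>i j. i \<in> multi_indices I \<Longrightarrow> j \<in> multi_indices J \<Longrightarrow> coef a i j = entry A (i @ j)"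
    and "\<And>i j. i \<notin> multi_indices I \<or> j \<notin> multi_indices J \<Longrightarrow> coef a i j = 0"
  shows "rep I J A a"
  using assms unfolding rep_def by simp

text \<open>Separates two tasks: the structure of a tensor expression first determines some
  representing matrix, and a ring identity then brings it into the desired form.\<close>

lemma rep_eq: "rep I J A a \<Longrightarrow> a = b \<Longrightarrow> rep I J A b"
  by simp

lemma rep_supp: "rep I J A a \<Longrightarrow> supp a \<subseteq> multi_indices I \<union> multi_indices J"
  by (auto simp: supp_def rep_coef split: if_splits)

text \<open>Makes tensor equations equivalent to ring equations: both objects vanish outside the
  index range and share the same entries inside.\<close>

lemma rep_eq_iff:
  assumes A: "rep I J A a" and B: "rep I J B b"
  shows "A = B \<longleftrightarrow> a = b"
proof
  assume "A = B"
  then show "a = b"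
    using A B by (intro qmat_eqI) (simp add: rep_coef)
next
  assume ab: "a = b"
  show "A = B"
  proof (rule tensor_eqI)
    show "dims A = dims B"
      using A B by (simp add: rep_def tensors_def)
    fix ix
    assume "ix \<in> multi_indices (dims A)"
    then have "ix \<in> multi_indices (I @ J)"
      using A by (simp add: rep_def tensors_def)
    then obtain i j where "ix = i @ j" "i \<in> multi_indices I" "j \<in> multi_indices J"
      by (rule multi_indices_appendE)
    then show "entry A ix = entry B ix"
      using rep_coef[OF A, of i j] rep_coef[OF B, of i j] ab by simp
  qed
qed

lemma ex_rep_matrix:
  assumes "A \<in> tensors (I @ J)"
  obtains a where "rep I J A a"
proof
  show "rep I J A (Abs_qmat (\<lambda>i j.
      if i \<in> multi_indices I \<and> j \<in> multi_indices J then entry A (i @ j) else 0))"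
    unfolding rep_def using assms
    by (subst coef_Abs_qmat[of "multi_indices I \<union> multi_indices J"]) auto
qed

lemma ex_rep_tensor:
  assumes "\<And>i j. i \<notin> multi_indices I \<or> j \<notin> multi_indices J \<Longrightarrow> coef a i j = 0"
  obtains A where "rep I J A a"
proof
  show "rep I J (mk_tensor (I @ J) (\<lambda>ix. coef a (take (length I) ix) (drop (length I) ix))) a"
    using assms
    by (intro repI) (auto simp: tensors_def multi_indices_append_iff multi_indices_length)
qed

lemma rep_zero: "rep I J (zero_tensor (I @ J)) 0"
  by (rule repI) (simp_all add: zero_tensor_def tensors_def)

lemma rep_add:
  assumes "rep I J A a" and "rep I J B b"
  shows "rep I J (A + B) (a + b)"
proof (rule repI)
  show "A + B \<in> tensors (I @ J)"
    using assms(1) by (simp add: rep_def tensors_def plus_tensor_def)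
  then show "coef (a + b) i j = entry (A + B) (i @ j)"
    if "i \<in> multi_indices I" "j \<in> multi_indices J" for i j
    using that assms(1)
    by (simp add: rep_coef[OF assms(1)] rep_coef[OF assms(2)] plus_tensor_def rep_def
        tensors_def multi_indices_append_iff multi_indices_length)
qed (auto simp: rep_coef[OF assms(1)] rep_coef[OF assms(2)])

lemma rep_diff:
  assumes "rep I J A a" and "rep I J B b"
  shows "rep I J (A - B) (a - b)"
proof (rule repI)
  show "A - B \<in> tensors (I @ J)"
    using assms(1) by (simp add: rep_def tensors_def minus_tensor_def)
  then show "coef (a - b) i j = entry (A - B) (i @ j)"
    if "i \<in> multi_indices I" "j \<in> multi_indices J" for i j
    using that assms(1)
    by (simp add: rep_coef[OF assms(1)] rep_coef[OF assms(2)] minus_tensor_def rep_def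
        tensors_def multi_indices_append_iff multi_indices_length)
qed (auto simp: rep_coef[OF assms(1)] rep_coef[OF assms(2)])

lemma rep_einstein:
  assumes A: "rep I J A a" and B: "rep J K B b" and n: "length J = n"
  shows "rep I K (A \<star>\<^bsub>n\<^esub> B) (a * b)"
proof (rule repI)
  show "A \<star>\<^bsub>n\<^esub> B \<in> tensors (I @ K)"
    using A B n by (auto intro: dims_einstein rep_tensors)
  have mult: "coef (a * b) i k = (\<Sum>j\<in>multi_indices J. coef a i j * coef b j k)" for i k
  proof -
    have "coef (a * b) i k = (\<Sum>j\<in>multi_indices I \<union> multi_indices J. coef a i j * coef b j k)"
      by (rule coef_mult) (simp_all add: rep_supp[OF A])
    also have "\<dots> = (\<Sum>j\<in>multi_indices J. coef a i j * coef b j k)"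
      by (rule sum.mono_neutral_right) (auto simp: rep_coef[OF A])
    finally show ?thesis .
  qed
  show "coef (a * b) i k = entry (A \<star>\<^bsub>n\<^esub> B) (i @ k)"
    if "i \<in> multi_indices I" "k \<in> multi_indices K" for i k
    unfolding mult entry_einstein[OF rep_tensors[OF A] rep_tensors[OF B] n that]
    using that by (intro sum.cong refl) (simp add: rep_coef[OF A] rep_coef[OF B])
  show "coef (a * b) i k = 0" if "i \<notin> multi_indices I \<or> k \<notin> multi_indices K" for i k
    using that by (auto simp: mult rep_coef[OF A] rep_coef[OF B])
qed

lemma square_dims:
  assumes "A \<in> tensors (I @ J)" and "length I = length J"
  shows "half A = length J" "row_dims A = I" "col_dims A = J"
  using assms by (simp_all add: half_def row_dims_def col_dims_def tensors_def)

lemma rep_conj_transpose: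
  assumes A: "rep I J A a" and len: "length I = length J"
  shows "rep J I (A\<^sup>\<star>) (adj a)"
proof (rule repI)
  show "A\<^sup>\<star> \<in> tensors (J @ I)"
    using square_dims[OF rep_tensors[OF A] len] by (simp add: conj_transpose_def tensors_def)
  show "coef (adj a) j i = entry (A\<^sup>\<star>) (j @ i)"
    if "j \<in> multi_indices J" "i \<in> multi_indices I" for i j
    using that entry_conj_transpose[OF rep_tensors[OF A] len refl]
    by (simp add: rep_coef[OF A])
  show "coef (adj a) j i = 0" if "j \<notin> multi_indices J \<or> i \<notin> multi_indices I" for i j
    using that by (auto simp: rep_coef[OF A])
qed

definition unit_mat :: "nat list \<Rightarrow> nat list qmat" where
  "unit_mat I = Abs_qmat (\<lambda>i j. if i = j \<and> i \<in> multi_indices I then 1 else 0)"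

lemma coef_unit_mat: "coef (unit_mat I) i j = (if i = j \<and> i \<in> multi_indices I then 1 else 0)"
  unfolding unit_mat_def by (subst coef_Abs_qmat[of "multi_indices I"]) auto

lemma rep_unit: "rep I I (unit_tensor I) (unit_mat I)"
  by (rule repI)
    (auto simp: coef_unit_mat unit_tensor_def tensors_def multi_indices_append_iff multi_indices_length)

lemma unit_mat_left:
  assumes "rep I J A a"
  shows "unit_mat I * a = a"
proof (rule qmat_eqI)
  fix i j
  have "coef (unit_mat I * a) i j = (\<Sum>l\<in>multi_indices I. coef (unit_mat I) i l * coef a l j)"
    using rep_supp[OF rep_unit] by (intro coef_mult) auto
  also have "\<dots> = (\<Sum>l\<in>multi_indices I. if i = l then coef a i j else 0)"
    by (intro sum.cong refl) (simp add: coef_unit_mat)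
  also have "\<dots> = coef a i j"
    by (simp add: rep_coef[OF assms])
  finally show "coef (unit_mat I * a) i j = coef a i j" .
qed

lemma unit_mat_right:
  assumes "rep I J A a"
  shows "a * unit_mat J = a"
proof (rule qmat_eqI)
  fix i j
  have "coef (a * unit_mat J) i j =
      (\<Sum>l\<in>multi_indices I \<union> multi_indices J. coef a i l * coef (unit_mat J) l j)"
    by (rule coef_mult) (simp_all add: rep_supp[OF assms])
  also have "\<dots> = (\<Sum>l\<in>multi_indices I \<union> multi_indices J. if l = j then coef a i j else 0)"
    by (intro sum.cong refl) (auto simp: coef_unit_mat rep_coef[OF assms])
  also have "\<dots> = coef a i j"
    by (simp add: rep_coef[OF assms])
  finally show "coef (a * unit_mat J) i j = coef a i j" .
qed

section \<open>Transfer of Moore-Penrose inverses and projections\<close>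

lemma is_MP_inverse_iff:
  assumes A: "rep I J A a" and X: "rep J I X x" and len: "length I = length J"
  shows "is_MP_inverse A X \<longleftrightarrow> is_pinv a x"
proof -
  note dims = square_dims[OF rep_tensors[OF A] len]
  note AX = rep_einstein[OF A X refl] and XA = rep_einstein[OF X A len]
  show ?thesis
    unfolding is_MP_inverse_def is_pinv_def dims
    using rep_tensors[OF X]
      rep_eq_iff[OF rep_einstein[OF AX A len] A] rep_eq_iff[OF rep_einstein[OF XA X refl] X]
      rep_eq_iff[OF rep_conj_transpose[OF AX refl] AX]
      rep_eq_iff[OF rep_conj_transpose[OF XA refl] XA]
    by simp
qed

text \<open>\<open>pinv a\<close> begins and ends with the factor \<open>adj a\<close>, hence is
  supported on \<open>J\<close> times \<open>I\<close> and comes from a tensor. Existence and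
  uniqueness of the tensor inverse are then inherited from the ring.\<close>

lemma rep_MP_inverse:
  assumes A: "rep I J A a" and len: "length I = length J"
  shows "rep J I (A\<^sup>\<dagger>) (pinv a)"
proof -
  have "coef (pinv a) j i = 0" if "j \<notin> multi_indices J \<or> i \<notin> multi_indices I" for j i
  proof -
    have adj: "rep J I (A\<^sup>\<star>) (adj a)"
      by (rule rep_conj_transpose[OF A len])
    have "unit_mat J * pinv a = pinv a"
      by (subst (1 2) pinv_right) (simp add: mult.assoc[symmetric] unit_mat_left[OF adj])
    moreover have "pinv a * unit_mat I = pinv a"
      by (subst (1 2) pinv_left) (simp add: mult.assoc unit_mat_right[OF adj])
    moreover have "coef (unit_mat J * pinv a) j i = 0" if "j \<notin> multi_indices J"
      using that by (simp add: coef_mult_supp coef_unit_mat)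
    moreover have "coef (pinv a * unit_mat I) j i = 0" if "i \<notin> multi_indices I"
      using that by (auto simp: coef_mult_supp coef_unit_mat intro!: sum.neutral)
    ultimately show ?thesis
      using that by auto
  qed
  then obtain X where X: "rep J I X (pinv a)"
    by (rule ex_rep_tensor)
  have "A\<^sup>\<dagger> = X"
    unfolding MP_inverse_def
  proof (rule the_equality)
    show "is_MP_inverse A X"
      using is_MP_inverse_iff[OF A X len] is_pinv_pinv by simp
    fix Y
    assume Y: "is_MP_inverse A Y"
    then have "Y \<in> tensors (J @ I)"
      using square_dims[OF rep_tensors[OF A] len] by (simp add: is_MP_inverse_def)
    then obtain y where y: "rep J I Y y"
      by (rule ex_rep_matrix)
    then have "pinv a = y"
      using is_MP_inverse_iff[OF A y len] Y by (intro pinv_eqI) simp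
    then show "Y = X"
      using rep_eq_iff[OF y X] by simp
  qed
  with X show ?thesis by simp
qed

lemma rep_L_proj:
  assumes A: "rep I J A a" and len: "length I = length J"
  shows "rep J J \<L>\<^bsub>A\<^esub> (unit_mat J - pinv a * a)"
  unfolding L_proj_def square_dims[OF rep_tensors[OF A] len]
  by (intro rep_diff rep_unit rep_einstein[OF rep_MP_inverse[OF A len] A len])

lemma rep_R_proj:
  assumes A: "rep I J A a" and len: "length I = length J"
  shows "rep I I \<R>\<^bsub>A\<^esub> (unit_mat I - a * pinv a)"
  unfolding R_proj_def square_dims[OF rep_tensors[OF A] len]
  by (intro rep_diff rep_unit rep_einstein[OF A rep_MP_inverse[OF A len] refl])

text \<open>Makes a rewrite rule for a product applicable inside products that are nested to the
  right.\<close>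

lemma mult_assoc_eq: "u * v = w \<Longrightarrow> u * (v * z) = w * (z :: 'a :: semigroup_mult)"
  by (simp add: mult.assoc[symmetric])

section \<open>The Sylvester tensor equation as a ring equation\<close>

theorem theorem5p1:
  fixes N M :: nat
    and I J G K H L :: "nat list"
    and A B C D E P Q S :: tensor
  assumes "length I = N" "length J = N" "length G = N"
    and "length K = M" "length H = M" "length L = M"
    and "A \<in> tensors (I @ J)"
    and "B \<in> tensors (K @ L)"
    and "C \<in> tensors (I @ G)"
    and "D \<in> tensors (H @ L)"
    and "E \<in> tensors (I @ L)"
    and "P = \<R>\<^bsub>A\<^esub> \<star>\<^bsub>N\<^esub> C"
    and "Q = D \<star>\<^bsub>M\<^esub> \<L>\<^bsub>B\<^esub>"
    and "S = C \<star>\<^bsub>N\<^esub> \<L>\<^bsub>P\<^esub>"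
  shows
    "((\<exists>X \<in> tensors (J @ K). \<exists>Y \<in> tensors (G @ H).
         A \<star>\<^bsub>N\<^esub> X \<star>\<^bsub>M\<^esub> B + C \<star>\<^bsub>N\<^esub> Y \<star>\<^bsub>M\<^esub> D = E)
      \<longleftrightarrow>
       \<R>\<^bsub>P\<^esub> \<star>\<^bsub>N\<^esub> \<R>\<^bsub>A\<^esub> \<star>\<^bsub>N\<^esub> E = zero_tensor (I @ L) \<and>
       E \<star>\<^bsub>M\<^esub> \<L>\<^bsub>B\<^esub> \<star>\<^bsub>M\<^esub> \<L>\<^bsub>Q\<^esub> = zero_tensor (I @ L) \<and>
       \<R>\<^bsub>A\<^esub> \<star>\<^bsub>N\<^esub> E \<star>\<^bsub>M\<^esub> \<L>\<^bsub>D\<^esub> = zero_tensor (I @ L) \<and>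
       \<R>\<^bsub>C\<^esub> \<star>\<^bsub>N\<^esub> E \<star>\<^bsub>M\<^esub> \<L>\<^bsub>B\<^esub> = zero_tensor (I @ L))
     \<and>
     ((\<exists>X \<in> tensors (J @ K). \<exists>Y \<in> tensors (G @ H).
         A \<star>\<^bsub>N\<^esub> X \<star>\<^bsub>M\<^esub> B + C \<star>\<^bsub>N\<^esub> Y \<star>\<^bsub>M\<^esub> D = E)
      \<longrightarrow>
      {(X, Y). X \<in> tensors (J @ K) \<and> Y \<in> tensors (G @ H) \<and>
         A \<star>\<^bsub>N\<^esub> X \<star>\<^bsub>M\<^esub> B + C \<star>\<^bsub>N\<^esub> Y \<star>\<^bsub>M\<^esub> D = E}
      =
      {(A\<^sup>\<dagger> \<star>\<^bsub>N\<^esub> E \<star>\<^bsub>M\<^esub> B\<^sup>\<dagger>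
          - A\<^sup>\<dagger> \<star>\<^bsub>N\<^esub> C \<star>\<^bsub>N\<^esub> P\<^sup>\<dagger> \<star>\<^bsub>N\<^esub> E \<star>\<^bsub>M\<^esub> B\<^sup>\<dagger>
          - A\<^sup>\<dagger> \<star>\<^bsub>N\<^esub> S \<star>\<^bsub>N\<^esub> C\<^sup>\<dagger> \<star>\<^bsub>N\<^esub> E \<star>\<^bsub>M\<^esub> Q\<^sup>\<dagger> \<star>\<^bsub>M\<^esub> D \<star>\<^bsub>M\<^esub> B\<^sup>\<dagger>
          - A\<^sup>\<dagger> \<star>\<^bsub>N\<^esub> S \<star>\<^bsub>N\<^esub> U\<^sub>2 \<star>\<^bsub>M\<^esub> \<R>\<^bsub>Q\<^esub> \<star>\<^bsub>M\<^esub> D \<star>\<^bsub>M\<^esub> B\<^sup>\<dagger>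
          + \<L>\<^bsub>A\<^esub> \<star>\<^bsub>N\<^esub> U\<^sub>4
          + U\<^sub>5 \<star>\<^bsub>M\<^esub> \<R>\<^bsub>B\<^esub>,
        P\<^sup>\<dagger> \<star>\<^bsub>N\<^esub> E \<star>\<^bsub>M\<^esub> D\<^sup>\<dagger>
          + S\<^sup>\<dagger> \<star>\<^bsub>N\<^esub> S \<star>\<^bsub>N\<^esub> C\<^sup>\<dagger> \<star>\<^bsub>N\<^esub> E \<star>\<^bsub>M\<^esub> Q\<^sup>\<dagger>
          + \<L>\<^bsub>P\<^esub> \<star>\<^bsub>N\<^esub> \<L>\<^bsub>S\<^esub> \<star>\<^bsub>N\<^esub> U\<^sub>1
          + \<L>\<^bsub>P\<^esub> \<star>\<^bsub>N\<^esub> U\<^sub>2 \<star>\<^bsub>M\<^esub> \<R>\<^bsub>Q\<^esub>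
          + U\<^sub>3 \<star>\<^bsub>M\<^esub> \<R>\<^bsub>D\<^esub>)
       | U\<^sub>1 U\<^sub>2 U\<^sub>3 U\<^sub>4 U\<^sub>5.
         U\<^sub>1 \<in> tensors (G @ H) \<and> U\<^sub>2 \<in> tensors (G @ H) \<and> U\<^sub>3 \<in> tensors (G @ H) \<and>
         U\<^sub>4 \<in> tensors (J @ K) \<and> U\<^sub>5 \<in> tensors (J @ K)})"
proof -
  obtain a b c d e where a: "rep I J A a" and b: "rep K L B b" and c: "rep I G C c"
    and d: "rep H L D d" and e: "rep I L E e"
    using assms(7-11) by (metis ex_rep_matrix)
  have len: "length I = length J" "length K = length L" "length I = length G" "length H = length L"
    using assms(1-6) by simp_all
  note proj_a = rep_L_proj[OF a len(1)] rep_R_proj[OF a len(1)]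
    and proj_b = rep_L_proj[OF b len(2)] rep_R_proj[OF b len(2)]
    and proj_c = rep_L_proj[OF c len(3)] rep_R_proj[OF c len(3)]
    and proj_d = rep_L_proj[OF d len(4)] rep_R_proj[OF d len(4)]
  note pinvs = rep_MP_inverse[OF a len(1)] rep_MP_inverse[OF b len(2)] rep_MP_inverse[OF c len(3)]
    rep_MP_inverse[OF d len(4)]

  define p where "p = c - a * pinv a * c"
  define q where "q = d - d * pinv b * b"
  define s where "s = c - c * pinv p * p"
  have p: "rep I G P p"
    unfolding assms(12)
    by (rule rep_eq[OF rep_einstein[OF proj_a(2) c \<open>length I = N\<close>]])
      (simp add: p_def left_diff_distrib unit_mat_left[OF c])
  have q: "rep H L Q q"
    unfolding assms(13)
    by (rule rep_eq[OF rep_einstein[OF d proj_b(1) \<open>length L = M\<close>]])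
      (simp add: q_def right_diff_distrib mult.assoc unit_mat_right[OF d])
  note proj_p = rep_L_proj[OF p len(3)] rep_R_proj[OF p len(3)]
  have s: "rep I G S s"
    unfolding assms(14)
    by (rule rep_eq[OF rep_einstein[OF c proj_p(1) \<open>length G = N\<close>]])
      (simp add: s_def right_diff_distrib mult.assoc unit_mat_right[OF c])
  note proj_q = rep_L_proj[OF q len(4)] rep_R_proj[OF q len(4)]
    and proj_s = rep_L_proj[OF s len(3)] rep_R_proj[OF s len(3)]
  interpret sylvester a b c d p q s
    by standard (fact p_def q_def s_def)+

  \<comment> \<open>These rules follow the structure of a tensor expression and produce its matrix;
    the length equations settle the side conditions on contracted modes.\<close>
  note rep_rules = rep_einstein rep_add rep_diff a b c d e p q s
    proj_a proj_b proj_c proj_d proj_p proj_q proj_s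
    pinvs rep_MP_inverse[OF p len(3)] rep_MP_inverse[OF q len(4)] rep_MP_inverse[OF s len(3)]
    assms(1-6)
  \<comment> \<open>These identities remove the unit matrices that \<L> and \<R> introduce.\<close>
  note units = a[THEN unit_mat_left] c[THEN unit_mat_left] e[THEN unit_mat_left]
    p[THEN unit_mat_left] d[THEN unit_mat_left]
    b[THEN unit_mat_right] d[THEN unit_mat_right] e[THEN unit_mat_right] q[THEN unit_mat_right]
    rep_MP_inverse[OF s len(3), THEN unit_mat_left]
  note units = units units[THEN mult_assoc_eq]
  note ring_simps = left_diff_distrib right_diff_distrib mult.assoc

  define conds where "conds \<longleftrightarrow>
    \<R>\<^bsub>P\<^esub> \<star>\<^bsub>N\<^esub> \<R>\<^bsub>A\<^esub> \<star>\<^bsub>N\<^esub> E = zero_tensor (I @ L) \<and>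
    E \<star>\<^bsub>M\<^esub> \<L>\<^bsub>B\<^esub> \<star>\<^bsub>M\<^esub> \<L>\<^bsub>Q\<^esub> = zero_tensor (I @ L) \<and>
    \<R>\<^bsub>A\<^esub> \<star>\<^bsub>N\<^esub> E \<star>\<^bsub>M\<^esub> \<L>\<^bsub>D\<^esub> = zero_tensor (I @ L) \<and>
    \<R>\<^bsub>C\<^esub> \<star>\<^bsub>N\<^esub> E \<star>\<^bsub>M\<^esub> \<L>\<^bsub>B\<^esub> = zero_tensor (I @ L)"
  \<comment> \<open>In the first two conditions the mixed terms vanish by
    \<open>pinv p * a = 0\<close> and \<open>b * pinv q = 0\<close>; this gives the unit-free form
    used in the ring.\<close>
  have "rep I L (\<R>\<^bsub>P\<^esub> \<star>\<^bsub>N\<^esub> \<R>\<^bsub>A\<^esub> \<star>\<^bsub>N\<^esub> E) (e - a * pinv a * e - p * pinv p * e)"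
    by (rule rep_eq, (rule rep_rules)+) (simp add: ring_simps units pinv_p_a[THEN mult_assoc_eq])
  moreover have "rep I L (E \<star>\<^bsub>M\<^esub> \<L>\<^bsub>B\<^esub> \<star>\<^bsub>M\<^esub> \<L>\<^bsub>Q\<^esub>) (e - e * pinv b * b - e * pinv q * q)"
    by (rule rep_eq, (rule rep_rules)+) (simp add: ring_simps units b_pinv_q[THEN mult_assoc_eq])
  moreover have "rep I L (\<R>\<^bsub>A\<^esub> \<star>\<^bsub>N\<^esub> E \<star>\<^bsub>M\<^esub> \<L>\<^bsub>D\<^esub>)
      (e - a * pinv a * e - (e - a * pinv a * e) * (pinv d * d))"
    by (rule rep_eq, (rule rep_rules)+) (simp add: ring_simps units)
  moreover have "rep I L (\<R>\<^bsub>C\<^esub> \<star>\<^bsub>N\<^esub> E \<star>\<^bsub>M\<^esub> \<L>\<^bsub>B\<^esub>)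
      (e - e * pinv b * b - c * pinv c * (e - e * pinv b * b))"
    by (rule rep_eq, (rule rep_rules)+) (simp add: ring_simps units)
  ultimately have conds: "conds \<longleftrightarrow>
      p * pinv p * e = e - a * pinv a * e \<and>
      e * pinv q * q = e - e * pinv b * b \<and>
      (e - a * pinv a * e) * (pinv d * d) = e - a * pinv a * e \<and>
      c * pinv c * (e - e * pinv b * b) = e - e * pinv b * b"
    unfolding conds_def
    by (simp only: rep_eq_iff[OF _ rep_zero] right_minus_eq) (simp only: eq_commute)

  have solution_iff: "A \<star>\<^bsub>N\<^esub> X \<star>\<^bsub>M\<^esub> B + C \<star>\<^bsub>N\<^esub> Y \<star>\<^bsub>M\<^esub> D = E \<longleftrightarrow> a * x * b + c * y * d = e"
    if xy: "rep J K X x" "rep G H Y y" for X Y x y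
    by (rule rep_eq_iff[OF _ e]) (rule rep_rules xy)+

  let ?X = "\<lambda>U\<^sub>2 U\<^sub>4 U\<^sub>5. A\<^sup>\<dagger> \<star>\<^bsub>N\<^esub> E \<star>\<^bsub>M\<^esub> B\<^sup>\<dagger>
        - A\<^sup>\<dagger> \<star>\<^bsub>N\<^esub> C \<star>\<^bsub>N\<^esub> P\<^sup>\<dagger> \<star>\<^bsub>N\<^esub> E \<star>\<^bsub>M\<^esub> B\<^sup>\<dagger>
        - A\<^sup>\<dagger> \<star>\<^bsub>N\<^esub> S \<star>\<^bsub>N\<^esub> C\<^sup>\<dagger> \<star>\<^bsub>N\<^esub> E \<star>\<^bsub>M\<^esub> Q\<^sup>\<dagger> \<star>\<^bsub>M\<^esub> D \<star>\<^bsub>M\<^esub> B\<^sup>\<dagger>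
        - A\<^sup>\<dagger> \<star>\<^bsub>N\<^esub> S \<star>\<^bsub>N\<^esub> U\<^sub>2 \<star>\<^bsub>M\<^esub> \<R>\<^bsub>Q\<^esub> \<star>\<^bsub>M\<^esub> D \<star>\<^bsub>M\<^esub> B\<^sup>\<dagger>
        + \<L>\<^bsub>A\<^esub> \<star>\<^bsub>N\<^esub> U\<^sub>4
        + U\<^sub>5 \<star>\<^bsub>M\<^esub> \<R>\<^bsub>B\<^esub>"
  let ?Y = "\<lambda>U\<^sub>1 U\<^sub>2 U\<^sub>3. P\<^sup>\<dagger> \<star>\<^bsub>N\<^esub> E \<star>\<^bsub>M\<^esub> D\<^sup>\<dagger>
          + S\<^sup>\<dagger> \<star>\<^bsub>N\<^esub> S \<star>\<^bsub>N\<^esub> C\<^sup>\<dagger> \<star>\<^bsub>N\<^esub> E \<star>\<^bsub>M\<^esub> Q\<^sup>\<dagger>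
          + \<L>\<^bsub>P\<^esub> \<star>\<^bsub>N\<^esub> \<L>\<^bsub>S\<^esub> \<star>\<^bsub>N\<^esub> U\<^sub>1
          + \<L>\<^bsub>P\<^esub> \<star>\<^bsub>N\<^esub> U\<^sub>2 \<star>\<^bsub>M\<^esub> \<R>\<^bsub>Q\<^esub>
          + U\<^sub>3 \<star>\<^bsub>M\<^esub> \<R>\<^bsub>D\<^esub>"
  have rep_X: "rep J K (?X U\<^sub>2 U\<^sub>4 U\<^sub>5) (sol_x e u\<^sub>2 u\<^sub>4 u\<^sub>5)"
    if u: "rep G H U\<^sub>2 u\<^sub>2" "rep J K U\<^sub>4 u\<^sub>4" "rep J K U\<^sub>5 u\<^sub>5" for U\<^sub>2 U\<^sub>4 U\<^sub>5 u\<^sub>2 u\<^sub>4 u\<^sub>5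
    by (rule rep_eq, (rule rep_rules u)+)
      (simp add: sol_x_def ring_simps units u(2)[THEN unit_mat_left] u(3)[THEN unit_mat_right])
  have rep_Y: "rep G H (?Y U\<^sub>1 U\<^sub>2 U\<^sub>3) (sol_y e u\<^sub>1 u\<^sub>2 u\<^sub>3)"
    if u: "rep G H U\<^sub>1 u\<^sub>1" "rep G H U\<^sub>2 u\<^sub>2" "rep G H U\<^sub>3 u\<^sub>3" for U\<^sub>1 U\<^sub>2 U\<^sub>3 u\<^sub>1 u\<^sub>2 u\<^sub>3
    by (rule rep_eq, (rule rep_rules u)+)
      (simp add: sol_y_def ring_simps units u(1,2)[THEN unit_mat_left]
        u(2)[THEN unit_mat_left, THEN mult_assoc_eq] u(2,3)[THEN unit_mat_right])

  have necessary: conds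
    if "X \<in> tensors (J @ K)" "Y \<in> tensors (G @ H)" "A \<star>\<^bsub>N\<^esub> X \<star>\<^bsub>M\<^esub> B + C \<star>\<^bsub>N\<^esub> Y \<star>\<^bsub>M\<^esub> D = E" for X Y
  proof -
    from that(1) obtain x where x: "rep J K X x" by (rule ex_rep_matrix)
    from that(2) obtain y where y: "rep G H Y y" by (rule ex_rep_matrix)
    have "a * x * b + c * y * d = e"
      using that(3) solution_iff[OF x y] by simp
    from consistent_imp_conditions[OF this] show ?thesis
      by (simp only: conds simp_thms)
  qed
  have sufficient: "?X U\<^sub>2 U\<^sub>4 U\<^sub>5 \<in> tensors (J @ K) \<and> ?Y U\<^sub>1 U\<^sub>2 U\<^sub>3 \<in> tensors (G @ H) \<and>
      A \<star>\<^bsub>N\<^esub> ?X U\<^sub>2 U\<^sub>4 U\<^sub>5 \<star>\<^bsub>M\<^esub> B + C \<star>\<^bsub>N\<^esub> ?Y U\<^sub>1 U\<^sub>2 U\<^sub>3 \<star>\<^bsub>M\<^esub> D = E"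
    if cond: conds and U: "U\<^sub>1 \<in> tensors (G @ H)" "U\<^sub>2 \<in> tensors (G @ H)" "U\<^sub>3 \<in> tensors (G @ H)"
      "U\<^sub>4 \<in> tensors (J @ K)" "U\<^sub>5 \<in> tensors (J @ K)" for U\<^sub>1 U\<^sub>2 U\<^sub>3 U\<^sub>4 U\<^sub>5
  proof -
    from U(1) obtain u\<^sub>1 where u\<^sub>1: "rep G H U\<^sub>1 u\<^sub>1" by (rule ex_rep_matrix)
    from U(2) obtain u\<^sub>2 where u\<^sub>2: "rep G H U\<^sub>2 u\<^sub>2" by (rule ex_rep_matrix)
    from U(3) obtain u\<^sub>3 where u\<^sub>3: "rep G H U\<^sub>3 u\<^sub>3" by (rule ex_rep_matrix)
    from U(4) obtain u\<^sub>4 where u\<^sub>4: "rep J K U\<^sub>4 u\<^sub>4" by (rule ex_rep_matrix)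
    from U(5) obtain u\<^sub>5 where u\<^sub>5: "rep J K U\<^sub>5 u\<^sub>5" by (rule ex_rep_matrix)
    note X = rep_X[OF u\<^sub>2 u\<^sub>4 u\<^sub>5] and Y = rep_Y[OF u\<^sub>1 u\<^sub>2 u\<^sub>3]
    have "a * sol_x e u\<^sub>2 u\<^sub>4 u\<^sub>5 * b + c * sol_y e u\<^sub>1 u\<^sub>2 u\<^sub>3 * d = e"
      using cond unfolding conds by (elim conjE) (rule sol_solves)
    then show ?thesis
      using rep_tensors[OF X] rep_tensors[OF Y] solution_iff[OF X Y] by (intro conjI) (simp only:)+
  qed
  have complete: "\<exists>U\<^sub>1 U\<^sub>2 U\<^sub>3 U\<^sub>4 U\<^sub>5. X = ?X U\<^sub>2 U\<^sub>4 U\<^sub>5 \<and> Y = ?Y U\<^sub>1 U\<^sub>2 U\<^sub>3 \<and>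
      U\<^sub>1 \<in> tensors (G @ H) \<and> U\<^sub>2 \<in> tensors (G @ H) \<and> U\<^sub>3 \<in> tensors (G @ H) \<and>
      U\<^sub>4 \<in> tensors (J @ K) \<and> U\<^sub>5 \<in> tensors (J @ K)"
    if "X \<in> tensors (J @ K)" "Y \<in> tensors (G @ H)" "A \<star>\<^bsub>N\<^esub> X \<star>\<^bsub>M\<^esub> B + C \<star>\<^bsub>N\<^esub> Y \<star>\<^bsub>M\<^esub> D = E" for X Y
  proof -
    from that(1) obtain x where x: "rep J K X x" by (rule ex_rep_matrix)
    from that(2) obtain y where y: "rep G H Y y" by (rule ex_rep_matrix)
    have eq: "a * x * b + c * y * d = e"
      using that(3) solution_iff[OF x y] by simp
    \<comment> \<open>The parameters chosen in \<open>sol_complete\<close> are realized by tensors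
      of the required sizes; the remaining ones are \<open>Y\<close> and \<open>X\<close>
      themselves.\<close>
    have u\<^sub>2: "rep G H (S\<^sup>\<dagger> \<star>\<^bsub>N\<^esub> S \<star>\<^bsub>N\<^esub> Y) (pinv s * s * y)"
      and u\<^sub>3: "rep G H (P\<^sup>\<dagger> \<star>\<^bsub>N\<^esub> P \<star>\<^bsub>N\<^esub> Y) (pinv p * p * y)"
      and u\<^sub>5: "rep J K (A\<^sup>\<dagger> \<star>\<^bsub>N\<^esub> A \<star>\<^bsub>N\<^esub> X) (pinv a * a * x)"
      by (rule rep_rules x y)+
    have "X = ?X (S\<^sup>\<dagger> \<star>\<^bsub>N\<^esub> S \<star>\<^bsub>N\<^esub> Y) X (A\<^sup>\<dagger> \<star>\<^bsub>N\<^esub> A \<star>\<^bsub>N\<^esub> X)"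
      using sol_complete(1)[OF eq] rep_eq_iff[OF x rep_X[OF u\<^sub>2 x u\<^sub>5]] by (rule iffD2[rotated])
    moreover have "Y = ?Y Y (S\<^sup>\<dagger> \<star>\<^bsub>N\<^esub> S \<star>\<^bsub>N\<^esub> Y) (P\<^sup>\<dagger> \<star>\<^bsub>N\<^esub> P \<star>\<^bsub>N\<^esub> Y)"
      using sol_complete(2)[OF eq] rep_eq_iff[OF y rep_Y[OF y u\<^sub>2 u\<^sub>3]] by (rule iffD2[rotated])
    ultimately show ?thesis
      using that(1,2) rep_tensors[OF u\<^sub>2] rep_tensors[OF u\<^sub>3] rep_tensors[OF u\<^sub>5] by blast
  qed

  let ?sol = "\<lambda>X Y. A \<star>\<^bsub>N\<^esub> X \<star>\<^bsub>M\<^esub> B + C \<star>\<^bsub>N\<^esub> Y \<star>\<^bsub>M\<^esub> D = E"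
  have zero: "zero_tensor ds \<in> tensors ds" for ds
    by (simp add: zero_tensor_def tensors_def)
  show ?thesis
    unfolding conds_def[symmetric]
  proof (intro conjI iffI impI)
    show conds if "\<exists>X \<in> tensors (J @ K). \<exists>Y \<in> tensors (G @ H). ?sol X Y"
      using that necessary by blast
    \<comment> \<open>Zero parameters give a particular solution, which proves consistency.\<close>
    show "\<exists>X \<in> tensors (J @ K). \<exists>Y \<in> tensors (G @ H). ?sol X Y" if conds
      using sufficient[OF that zero zero zero zero zero] by blast
    assume "\<exists>X \<in> tensors (J @ K). \<exists>Y \<in> tensors (G @ H). ?sol X Y"
    then have conds
      using necessary by blast
    show "{(X, Y). X \<in> tensors (J @ K) \<and> Y \<in> tensors (G @ H) \<and> ?sol X Y} =
      {(?X U\<^sub>2 U\<^sub>4 U\<^sub>5, ?Y U\<^sub>1 U\<^sub>2 U\<^sub>3) | U\<^sub>1 U\<^sub>2 U\<^sub>3 U\<^sub>4 U\<^sub>5.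
         U\<^sub>1 \<in> tensors (G @ H) \<and> U\<^sub>2 \<in> tensors (G @ H) \<and> U\<^sub>3 \<in> tensors (G @ H) \<and>
         U\<^sub>4 \<in> tensors (J @ K) \<and> U\<^sub>5 \<in> tensors (J @ K)}" (is "?lhs = ?rhs")
    proof
      show "?lhs \<subseteq> ?rhs"
      proof
        fix z
        assume "z \<in> ?lhs"
        then obtain X Y where "z = (X, Y)" "X \<in> tensors (J @ K)" "Y \<in> tensors (G @ H)" "?sol X Y"
          by blast
        with complete[of X Y] show "z \<in> ?rhs"
          by (simp only: mem_Collect_eq prod.inject conj_assoc simp_thms)
      qed
      show "?rhs \<subseteq> ?lhs"
      proof
        fix z
        assume "z \<in> ?rhs"
        then obtain U\<^sub>1 U\<^sub>2 U\<^sub>3 U\<^sub>4 U\<^sub>5 where z: "z = (?X U\<^sub>2 U\<^sub>4 U\<^sub>5, ?Y U\<^sub>1 U\<^sub>2 U\<^sub>3)"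
          and "U\<^sub>1 \<in> tensors (G @ H)" "U\<^sub>2 \<in> tensors (G @ H)" "U\<^sub>3 \<in> tensors (G @ H)"
            "U\<^sub>4 \<in> tensors (J @ K)" "U\<^sub>5 \<in> tensors (J @ K)"
          by blast
        from sufficient[OF \<open>conds\<close> this(2-6)] show "z \<in> ?lhs"
          unfolding z by (simp only: mem_Collect_eq prod.case simp_thms)
      qed
    qed
  qed
qed

end
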